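(* Let $u\le_k w$ in $S_n$. If $F$ is a face of $\sigma_k(\Delta([u,w]))$ of dimension $\ell(w)-\ell(u)-1$ (called a ridge), then $F$ lies in either one or two $(\ell(w)-\ell(u))$-dimensional faces of $\sigma_k(\Delta([u,w]))$; $F$ is called exterior or interior respectively. If $F$ lies in $\sigma_k(\Delta([u',w']))$ for some $\langle u',w'\rangle\in\mathcal Q(k,n)$ with $\langle u',w'\rangle>\langle u,w\rangle$ in $\mathcal Q(k,n)$, then $F$ lies in an exterior ridge of $\sigma_k(\Delta([u,w]))$.
   Context: Fix integers $0\le k\le n$. On $S_n$, $\ell$ is the number of inversions, $\le$ is Bruhat order with covers $\lessdot$, and $\sigma_k(v)=v([k])$, a $k$-element subset of $[n]$. The $k$-Bruhat order $\le_k$ is the reflexive-transitive closure of: $x\lessdot_k y$ iff $x\lessdot y$ and $\sigma_k(x)\ne\sigma_k(y)$. $[u,w]$ and $[u,w]_k$ are the Bruhat and $k$-Bruhat intervals. $\Delta([u,w])$ is the order complex of $[u,w]$ (faces are chains), and $\sigma_k(\Delta([u,w]))$ is the simplicial complex whose faces are the images under $\sigma_k$ of chains of $[u,w]$. $\mathcal Q(k,n)$ is the set of equivalence classes $\langle u,w\rangle$ of $k$-Bruhat intervals $[u,w]_k$ ($u\le_k w$) under the equivalence relation generated by $[u,w]_k\sim[uz,wz]_k$ for $z\in S_k\times S_{n-k}$ (permutations preserving $[k]$) with $\ell(uz)=\ell(u)+\ell(z)$ and $\ell(wz)=\ell(w)+\ell(z)$. It is partially ordered by: $q'\le q$ iff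 there are representatives $[x,y]_k\in q$, $[x',y']_k\in q'$ with $[x',y']\supseteq[x,y]$ (so larger elements correspond to smaller intervals). The complex $\sigma_k(\Delta([u,w]))$ depends only on the class $\langle u,w\rangle$. *)

theory Defs
  imports "HOL-Combinatorics.Permutations" "HOL.Complete_Partial_Order"
begin

text \<open>
  Elements of \<open>S\<^sub>n\<close> are functions \<^typ>\<open>nat \<Rightarrow> nat\<close> permuting \<open>{1..n}\<close> and fixing everything else;
  the product \<open>uz\<close> is the composition \<open>u \<circ> z\<close>.
\<close>

definition Sym :: "nat \<Rightarrow> (nat \<Rightarrow> nat) set" where
  "Sym n = {v. v permutes {1..n}}"

definition len :: "nat \<Rightarrow> (nat \<Rightarrow> nat) \<Rightarrow> nat" where
  "len n v = card {(i, j). 1 \<le> i \<and> i < j \<and> j \<le> n \<and> v j < v i}"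

definition sigma :: "nat \<Rightarrow> (nat \<Rightarrow> nat) \<Rightarrow> nat set" where
  "sigma k v = v ` {1..k}"


section \<open>Bruhat order and \<open>k\<close>-Bruhat order\<close>

definition bruhat_step :: "nat \<Rightarrow> (nat \<Rightarrow> nat) \<Rightarrow> (nat \<Rightarrow> nat) \<Rightarrow> bool" where
  "bruhat_step n x y \<longleftrightarrow> x \<in> Sym n \<and>
     (\<exists>a b. 1 \<le> a \<and> a < b \<and> b \<le> n \<and> y = x \<circ> transpose a b) \<and> len n x < len n y"

text \<open>All the relations below are relations on \<^term>\<open>Sym n\<close>: reflexivity holds only there.\<close>

definition bruhat_le :: "nat \<Rightarrow> (nat \<Rightarrow> nat) \<Rightarrow> (nat \<Rightarrow> nat) \<Rightarrow> bool" where
  "bruhat_le n x y \<longleftrightarrow> x \<in> Sym n \<and> (bruhat_step n)\<^sup>*\<^sup>* x y"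

definition bruhat_less :: "nat \<Rightarrow> (nat \<Rightarrow> nat) \<Rightarrow> (nat \<Rightarrow> nat) \<Rightarrow> bool" where
  "bruhat_less n x y \<longleftrightarrow> bruhat_le n x y \<and> x \<noteq> y"

definition bruhat_cover :: "nat \<Rightarrow> (nat \<Rightarrow> nat) \<Rightarrow> (nat \<Rightarrow> nat) \<Rightarrow> bool" where
  "bruhat_cover n x y \<longleftrightarrow> bruhat_less n x y \<and> (\<nexists>v. bruhat_less n x v \<and> bruhat_less n v y)"

definition k_bruhat_cover :: "nat \<Rightarrow> nat \<Rightarrow> (nat \<Rightarrow> nat) \<Rightarrow> (nat \<Rightarrow> nat) \<Rightarrow> bool" where
  "k_bruhat_cover k n x y \<longleftrightarrow> bruhat_cover n x y \<and> sigma k x \<noteq> sigma k y"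

definition k_bruhat_le :: "nat \<Rightarrow> nat \<Rightarrow> (nat \<Rightarrow> nat) \<Rightarrow> (nat \<Rightarrow> nat) \<Rightarrow> bool" where
  "k_bruhat_le k n x y \<longleftrightarrow> x \<in> Sym n \<and> (k_bruhat_cover k n)\<^sup>*\<^sup>* x y"

definition bruhat_interval :: "nat \<Rightarrow> (nat \<Rightarrow> nat) \<Rightarrow> (nat \<Rightarrow> nat) \<Rightarrow> (nat \<Rightarrow> nat) set" where
  "bruhat_interval n u w = {v. bruhat_le n u v \<and> bruhat_le n v w}"


section \<open>The complex \<open>\<sigma>\<^sub>k(\<Delta>([u,w]))\<close>\<close>

text \<open>
  A complex is its set of faces; the empty set is a face, of dimension \<open>-1\<close>.
  All chains considered are finite, being subsets of \<^term>\<open>Sym n\<close>.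
\<close>

definition order_complex :: "nat \<Rightarrow> (nat \<Rightarrow> nat) \<Rightarrow> (nat \<Rightarrow> nat) \<Rightarrow> (nat \<Rightarrow> nat) set set" where
  "order_complex n u w =
     {C. C \<subseteq> bruhat_interval n u w \<and> Complete_Partial_Order.chain (bruhat_le n) C}"

definition sigma_complex :: "nat \<Rightarrow> nat \<Rightarrow> (nat \<Rightarrow> nat) \<Rightarrow> (nat \<Rightarrow> nat) \<Rightarrow> nat set set set" where
  "sigma_complex k n u w = (\<lambda>C. sigma k ` C) ` order_complex n u w"

definition face_dim :: "'a set \<Rightarrow> int" where
  "face_dim F = int (card F) - 1"

definition top_faces :: "nat \<Rightarrow> nat \<Rightarrow> (nat \<Rightarrow> nat) \<Rightarrow> (nat \<Rightarrow> nat) \<Rightarrow> nat set set set" where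
  "top_faces k n u w =
     {G \<in> sigma_complex k n u w. face_dim G = int (len n w) - int (len n u)}"

definition ridges :: "nat \<Rightarrow> nat \<Rightarrow> (nat \<Rightarrow> nat) \<Rightarrow> (nat \<Rightarrow> nat) \<Rightarrow> nat set set set" where
  "ridges k n u w =
     {F \<in> sigma_complex k n u w. face_dim F = int (len n w) - int (len n u) - 1}"

definition exterior_ridge ::
    "nat \<Rightarrow> nat \<Rightarrow> (nat \<Rightarrow> nat) \<Rightarrow> (nat \<Rightarrow> nat) \<Rightarrow> nat set set \<Rightarrow> bool" where
  "exterior_ridge k n u w F \<longleftrightarrow>
     F \<in> ridges k n u w \<and> card {G \<in> top_faces k n u w. F \<subseteq> G} = 1"

definition interior_ridge ::
    "nat \<Rightarrow> nat \<Rightarrow> (nat \<Rightarrow> nat) \<Rightarrow> (nat \<Rightarrow> nat) \<Rightarrow> nat set set \<Rightarrow> bool" where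
  "interior_ridge k n u w F \<longleftrightarrow>
     F \<in> ridges k n u w \<and> card {G \<in> top_faces k n u w. F \<subseteq> G} = 2"


section \<open>The poset \<open>Q(k,n)\<close>\<close>

text \<open>
  A \<open>k\<close>-Bruhat interval \<open>[u,w]\<^sub>k\<close> with \<open>u \<le>\<^sub>k w\<close> is represented by the pair of its endpoints,
  which it determines as its least and greatest element.
\<close>

definition k_intervals :: "nat \<Rightarrow> nat \<Rightarrow> ((nat \<Rightarrow> nat) \<times> (nat \<Rightarrow> nat)) set" where
  "k_intervals k n = {(u, w). k_bruhat_le k n u w}"

definition parabolic :: "nat \<Rightarrow> nat \<Rightarrow> (nat \<Rightarrow> nat) set" where
  "parabolic k n = {z \<in> Sym n. z ` {1..k} = {1..k}}"

definition Q_gen ::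
    "nat \<Rightarrow> nat \<Rightarrow> (nat \<Rightarrow> nat) \<times> (nat \<Rightarrow> nat) \<Rightarrow> (nat \<Rightarrow> nat) \<times> (nat \<Rightarrow> nat) \<Rightarrow> bool" where
  "Q_gen k n p q \<longleftrightarrow> p \<in> k_intervals k n \<and> q \<in> k_intervals k n \<and>
     (\<exists>z \<in> parabolic k n. q = (fst p \<circ> z, snd p \<circ> z) \<and>
        len n (fst p \<circ> z) = len n (fst p) + len n z \<and>
        len n (snd p \<circ> z) = len n (snd p) + len n z)"

definition Q_rel ::
    "nat \<Rightarrow> nat \<Rightarrow> (((nat \<Rightarrow> nat) \<times> (nat \<Rightarrow> nat)) \<times> ((nat \<Rightarrow> nat) \<times> (nat \<Rightarrow> nat))) set" where
  "Q_rel k n = {(p, q). p \<in> k_intervals k n \<and> q \<in> k_intervals k n \<and> equivclp (Q_gen k n) p q}"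

definition Q :: "nat \<Rightarrow> nat \<Rightarrow> ((nat \<Rightarrow> nat) \<times> (nat \<Rightarrow> nat)) set set" where
  "Q k n = k_intervals k n // Q_rel k n"

definition Q_class ::
    "nat \<Rightarrow> nat \<Rightarrow> (nat \<Rightarrow> nat) \<Rightarrow> (nat \<Rightarrow> nat) \<Rightarrow> ((nat \<Rightarrow> nat) \<times> (nat \<Rightarrow> nat)) set" where
  "Q_class k n u w = Q_rel k n `` {(u, w)}"

text \<open>The order is reversed: larger elements have smaller (ordinary) Bruhat intervals.\<close>

definition Q_le ::
    "nat \<Rightarrow> nat \<Rightarrow> ((nat \<Rightarrow> nat) \<times> (nat \<Rightarrow> nat)) set \<Rightarrow> ((nat \<Rightarrow> nat) \<times> (nat \<Rightarrow> nat)) set \<Rightarrow> bool" where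
  "Q_le k n q' q \<longleftrightarrow> q' \<in> Q k n \<and> q \<in> Q k n \<and>
     (\<exists>x y x' y'. (x, y) \<in> q \<and> (x', y') \<in> q' \<and>
        bruhat_interval n x y \<subseteq> bruhat_interval n x' y')"

definition Q_less ::
    "nat \<Rightarrow> nat \<Rightarrow> ((nat \<Rightarrow> nat) \<times> (nat \<Rightarrow> nat)) set \<Rightarrow> ((nat \<Rightarrow> nat) \<times> (nat \<Rightarrow> nat)) set \<Rightarrow> bool" where
  "Q_less k n q' q \<longleftrightarrow> Q_le k n q' q \<and> q' \<noteq> q"

end

theory Submission
  imports Defs
begin

text \<open>
  Write \<open>r = len n w - len n u\<close>, and call a Bruhat cover that does not change \<^term>\<open>sigma k\<close> a
  block cover. A \<open>k\<close>-Bruhat cover replaces one element of \<^term>\<open>sigma k\<close> by a larger one, so the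
  sum of the image increases strictly along \<open>k\<close>-Bruhat chains. Moreover, each end of such a cover is
  determined by the other end and the two images. A saturated \<open>k\<close>-Bruhat chain from \<open>u\<close> to \<open>w\<close> is
  therefore recovered from the set of its \<open>r + 1\<close> images. The proof rests on three facts.

  \<^item> Purity (\<open>bruhat_chain_in_k_chain\<close>): if \<open>u \<le>\<^sub>k w\<close>, then the image of every Bruhat chain from
    \<open>u\<close> to \<open>w\<close> is contained in the image of a saturated \<open>k\<close>-Bruhat chain from \<open>u\<close> to \<open>w\<close>. Hence the
    top faces are the images of these chains, and every face lies in one. A block cover followed
    by a \<open>k\<close>-Bruhat cover can be replaced, without losing an image, by a \<open>k\<close>-Bruhat cover followed
    by a block cover or by two \<open>k\<close>-Bruhat covers (\<open>block_then_k_cover\<close>). So one may assume that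
    the chain climbs in the \<open>k\<close>-Bruhat order from \<open>u\<close> to some \<open>x\<close> and then inside a coset of
    \<open>S\<^sub>k \<times> S\<^sub>n\<^sub>-\<^sub>k\<close> from \<open>x\<close> to \<open>w\<close>. For a simple transposition \<open>s\<close> of a block with \<open>ws < w\<close> the
    hypothesis \<open>u \<le>\<^sub>k w\<close> implies \<open>us < u\<close>. If \<open>xs < x\<close>, everything is translated by \<open>s\<close>, which
    does not change the images; otherwise \<open>xs \<le> w\<close>, and the step from \<open>x\<close> to \<open>xs\<close> is absorbed into
    the \<open>k\<close>-Bruhat chain. Induction removes the gap (\<open>block_gap_reduction\<close>).

  \<^item> At most two top faces contain a ridge (\<open>facets_over_not_three\<close>). If the one missing element is
    \<open>\<sigma>\<^sub>k(u)\<close> or \<open>\<sigma>\<^sub>k(w)\<close>, it is unique. Otherwise the chain is determined by \<open>u\<close> below the gap and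
    by \<open>w\<close> above it, and the gap is filled by one middle element of an interval of length two. Such
    an interval offers at most two images, and only one if its ends differ by a single exchange,
    which happens as soon as another top face over the same ridge has its gap elsewhere. Finally a
    gap strictly between two others is excluded by the positions of the three values involved
    (\<open>middle_between_singles_impossible\<close>).

  \<^item> A face that comes from a Bruhat chain from \<open>u\<close> to some \<open>y < w\<close> lies in an exterior ridge
    (\<open>lower_chain_exterior\<close>). Moving block covers upwards either yields a \<open>k\<close>-Bruhat chain through
    the face that stops below \<open>w\<close>, and then the face lies in a ridge that omits \<open>\<sigma>\<^sub>k(w)\<close>; or it
    leaves block covers at the top. In the second case the induction above, stopped one step early,
    gives up to translation a \<open>k\<close>-Bruhat chain from \<open>u\<close> to an element one block cover below \<open>w\<close>. Its
    image is a ridge, and the previous counting argument, with this chain in place of one of the top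
    faces, shows that it lies in only one top face (\<open>facets_over_collapsed_end\<close>).

  If \<open>\<langle>u',w'\<rangle> > \<langle>u,w\<rangle>\<close>, there are representatives \<open>[x,y] \<subseteq> [a,b]\<close> of the two classes, with
  \<open>(x,y) \<noteq> (a,b)\<close>. Translation does not change images, so both complexes may be computed from these
  representatives. If \<open>y \<noteq> b\<close>, the third fact applies; if \<open>x \<noteq> a\<close>, it applies after reversing all
  values, which reverses the orders (\<open>upper_chain_exterior\<close>).
\<close>

section \<open>Transpositions and the number of inversions\<close>

lemma transpose_swaps_order:
  fixes i j a b :: nat
  assumes "i < j" "a < b" "transpose a b j \<le> transpose a b i"
  shows "i = a \<and> j \<le> b \<or> j = b \<and> a \<le> i"
  using assms by (auto simp: transpose_def split: if_splits)

definition inv_pairs :: "nat \<Rightarrow> (nat \<Rightarrow> nat) \<Rightarrow> (nat \<times> nat) set" where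
  "inv_pairs n v = {(i, j). 1 \<le> i \<and> i < j \<and> j \<le> n \<and> v j < v i}"

lemma len_eq_card_inv_pairs: "len n v = card (inv_pairs n v)"
  by (simp add: len_def inv_pairs_def)

lemma finite_inv_pairs [simp]: "finite (inv_pairs n v)"
proof (rule finite_subset)
  show "inv_pairs n v \<subseteq> {1..n} \<times> {1..n}" by (auto simp: inv_pairs_def)
qed simp

text \<open>
  The injection from the inversions of \<open>x\<close> to those of \<open>x \<circ> transpose a b\<close>: positions are
  relabelled by the transposition wherever this keeps them in order.
\<close>

definition move_pair :: "nat \<Rightarrow> nat \<Rightarrow> nat \<times> nat \<Rightarrow> nat \<times> nat" where
  "move_pair a b = (\<lambda>(i, j). if transpose a b i < transpose a b j
     then (transpose a b i, transpose a b j) else (i, j))"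

lemma inj_move_pair: "inj_on (move_pair a b) {(i, j). i < j}"
  unfolding inj_on_def move_pair_def
  by (auto split: if_splits dest: transpose_eq_imp_eq simp: transpose_eq_iff)

lemma move_pair_inv_pairs:
  assumes "1 \<le> a" "a < b" "b \<le> n" "x a < x b"
  shows "move_pair a b ` inv_pairs n x \<subseteq> inv_pairs n (x \<circ> transpose a b) - {(a, b)}"
proof (rule image_subsetI)
  fix p assume "p \<in> inv_pairs n x"
  then obtain i j where p: "p = (i, j)" and ij: "1 \<le> i" "i < j" "j \<le> n" "x j < x i"
    by (auto simp: inv_pairs_def)
  show "move_pair a b p \<in> inv_pairs n (x \<circ> transpose a b) - {(a, b)}"
  proof (cases "transpose a b i < transpose a b j")
    case True
    have "1 \<le> transpose a b i" "transpose a b j \<le> n"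
      using ij assms by (auto simp: transpose_def)
    with True ij assms show ?thesis
      by (auto simp: p move_pair_def inv_pairs_def transpose_def split: if_splits)
  next
    case False
    with ij assms transpose_swaps_order[of i j a b] show ?thesis
      by (auto simp: p move_pair_def inv_pairs_def transpose_def split: if_splits)
  qed
qed

lemma len_less_transpose:
  assumes "1 \<le> a" "a < b" "b \<le> n" "x a < x b"
  shows "len n x < len n (x \<circ> transpose a b)"
proof -
  let ?y = "x \<circ> transpose a b"
  have "card (inv_pairs n x) = card (move_pair a b ` inv_pairs n x)"
    by (rule card_image[symmetric], rule inj_on_subset[OF inj_move_pair])
      (auto simp: inv_pairs_def)
  also have "\<dots> \<le> card (inv_pairs n ?y - {(a, b)})"
    by (rule card_mono) (use move_pair_inv_pairs[of a b n x] assms in auto)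
  also have "\<dots> < card (inv_pairs n ?y)"
    by (rule card_Diff1_less[OF finite_inv_pairs])
      (use assms in \<open>auto simp: inv_pairs_def\<close>)
  finally show ?thesis by (simp add: len_eq_card_inv_pairs)
qed

text \<open>
  The only new inversions besides \<open>(a, b)\<close> would involve a position between \<open>a\<close> and \<open>b\<close> whose
  value lies between \<open>x a\<close> and \<open>x b\<close>.
\<close>

lemma len_transpose_Suc:
  assumes "inj x" "1 \<le> a" "a < b" "b \<le> n" "x a < x b"
    and gap: "\<And>c. a < c \<Longrightarrow> c < b \<Longrightarrow> \<not> (x a < x c \<and> x c < x b)"
  shows "len n (x \<circ> transpose a b) = Suc (len n x)"
proof -
  let ?y = "x \<circ> transpose a b"
  have "inv_pairs n ?y - {(a, b)} \<subseteq> move_pair a b ` inv_pairs n x"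
  proof (rule subrelI)
    fix i j assume "(i, j) \<in> inv_pairs n ?y - {(a, b)}"
    then have ij': "(i, j) \<in> inv_pairs n ?y" "(i, j) \<noteq> (a, b)" by auto
    then have ij: "1 \<le> i" "i < j" "j \<le> n" "?y j < ?y i" by (auto simp: inv_pairs_def)
    show "(i, j) \<in> move_pair a b ` inv_pairs n x"
    proof (cases "transpose a b i < transpose a b j")
      case True
      have "(transpose a b i, transpose a b j) \<in> inv_pairs n x"
        using True ij assms by (auto simp: inv_pairs_def transpose_def)
      moreover have "move_pair a b (transpose a b i, transpose a b j) = (i, j)"
        using ij by (simp add: move_pair_def)
      ultimately show ?thesis by (metis image_eqI)
    next
      case False
      have c: "i = a \<and> j < b \<or> j = b \<and> a < i"
        using transpose_swaps_order[of i j a b] ij ij' assms False by fastforce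
      have ne: "x j \<noteq> x i" "j < b \<Longrightarrow> x j \<noteq> x b" "a < i \<Longrightarrow> x i \<noteq> x a"
        using \<open>inj x\<close> ij by (auto simp: inj_eq)
      have "x j < x i"
        using c
      proof
        assume h: "i = a \<and> j < b"
        then have "x j < x b" using ij ne by (auto simp: transpose_def split: if_splits)
        then show ?thesis using gap[of j] h ij ne by auto
      next
        assume h: "j = b \<and> a < i"
        then have "x a < x i" using ij ne by (auto simp: transpose_def split: if_splits)
        then show ?thesis using gap[of i] h ij ne by auto
      qed
      then have "(i, j) \<in> inv_pairs n x" using ij by (auto simp: inv_pairs_def)
      moreover have "move_pair a b (i, j) = (i, j)" using False by (simp add: move_pair_def)
      ultimately show ?thesis by (metis image_eqI)
    qed
  qed
  then have "inv_pairs n ?y - {(a, b)} = move_pair a b ` inv_pairs n x"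
    using move_pair_inv_pairs[of a b n x] assms by blast
  moreover have "card (move_pair a b ` inv_pairs n x) = card (inv_pairs n x)"
    by (rule card_image, rule inj_on_subset[OF inj_move_pair]) (auto simp: inv_pairs_def)
  moreover have "(a, b) \<in> inv_pairs n ?y" using assms by (auto simp: inv_pairs_def)
  ultimately show ?thesis
    by (metis len_eq_card_inv_pairs card_Suc_Diff1 finite_inv_pairs)
qed

lemma Sym_inj: "x \<in> Sym n \<Longrightarrow> inj x"
  by (auto simp: Sym_def permutes_inj)

lemma Sym_transpose:
  "x \<in> Sym n \<Longrightarrow> 1 \<le> a \<Longrightarrow> a \<le> n \<Longrightarrow> 1 \<le> b \<Longrightarrow> b \<le> n \<Longrightarrow> x \<circ> transpose a b \<in> Sym n"
  unfolding Sym_def by (auto intro!: permutes_compose permutes_swap_id)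

lemma transpose_transpose_comp [simp]: "x \<circ> transpose a b \<circ> transpose a b = x"
  by (simp add: comp_assoc)

lemma len_transpose_iff:
  assumes "x \<in> Sym n" "1 \<le> a" "a < b" "b \<le> n"
  shows "len n x < len n (x \<circ> transpose a b) \<longleftrightarrow> x a < x b"
proof
  assume l: "len n x < len n (x \<circ> transpose a b)"
  show "x a < x b"
  proof (rule ccontr)
    assume "\<not> x a < x b"
    then have "x b < x a" using Sym_inj[OF assms(1)] assms by (metis inj_eq nat_neq_iff)
    then have "len n (x \<circ> transpose a b) < len n (x \<circ> transpose a b \<circ> transpose a b)"
      using assms by (intro len_less_transpose) auto
    with l show False by simp
  qed
qed (use assms in \<open>auto intro: len_less_transpose\<close>)

text \<open>
  A transposition \<open>(a b)\<close> across an intermediate position \<open>c\<close> with intermediate value turns the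
  pattern 123 into 321; it factors through the patterns 213 and 312, each step adding inversions.
  This is why such a transposition is not a Bruhat cover, and how it is refined into covers.
\<close>

lemma transpose_as_three_steps:
  fixes a b c :: nat
  assumes "a < c" "c < b"
  shows "x \<circ> transpose a c \<circ> transpose a b \<circ> transpose c b = x \<circ> transpose a b"
proof -
  have "a \<noteq> c" "c \<noteq> b" "a \<noteq> b" using assms by auto
  then show ?thesis by (auto simp: fun_eq_iff transpose_def)
qed

lemma len_transpose_between:
  assumes "1 \<le> a" "a < c" "c < b" "b \<le> n" "x a < x c" "x c < x b"
  shows "len n x < len n (x \<circ> transpose a c)"
    "len n (x \<circ> transpose a c) < len n (x \<circ> transpose a c \<circ> transpose a b)"
    "len n (x \<circ> transpose a c \<circ> transpose a b) < len n (x \<circ> transpose a b)"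
proof -
  show "len n x < len n (x \<circ> transpose a c)" using assms by (intro len_less_transpose) auto
  show "len n (x \<circ> transpose a c) < len n (x \<circ> transpose a c \<circ> transpose a b)"
    using assms by (intro len_less_transpose) (auto simp: transpose_def)
  have "len n (x \<circ> transpose a c \<circ> transpose a b)
      < len n (x \<circ> transpose a c \<circ> transpose a b \<circ> transpose c b)"
    using assms by (intro len_less_transpose) (auto simp: transpose_def)
  then show "len n (x \<circ> transpose a c \<circ> transpose a b) < len n (x \<circ> transpose a b)"
    using assms by (simp add: transpose_as_three_steps)
qed

section \<open>Covers in the Bruhat order\<close>

lemma rtranclp_len_less:
  assumes "(bruhat_step n)\<^sup>*\<^sup>* x y"
  shows "x = y \<or> len n x < len n y"
  using assms by induction (auto simp: bruhat_step_def)

lemma bruhat_step_Sym: "bruhat_step n x y \<Longrightarrow> y \<in> Sym n"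
  by (auto simp: bruhat_step_def intro: Sym_transpose)

lemma bruhat_steps_Sym: "(bruhat_step n)\<^sup>*\<^sup>* x y \<Longrightarrow> x \<in> Sym n \<Longrightarrow> y \<in> Sym n"
  by (induction rule: rtranclp_induct) (auto dest: bruhat_step_Sym)

lemma bruhat_le_Sym: "bruhat_le n x y \<Longrightarrow> x \<in> Sym n \<and> y \<in> Sym n"
  by (auto simp: bruhat_le_def intro: bruhat_steps_Sym)

lemma bruhat_le_trans: "bruhat_le n x y \<Longrightarrow> bruhat_le n y z \<Longrightarrow> bruhat_le n x z"
  by (auto simp: bruhat_le_def)

lemma bruhat_le_refl: "x \<in> Sym n \<Longrightarrow> bruhat_le n x x"
  by (auto simp: bruhat_le_def)

lemma bruhat_less_len: "bruhat_less n x y \<Longrightarrow> len n x < len n y"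
  using rtranclp_len_less by (auto simp: bruhat_less_def bruhat_le_def)

lemma bruhat_le_len: "bruhat_le n x y \<Longrightarrow> len n x \<le> len n y"
  using rtranclp_len_less by (fastforce simp: bruhat_le_def)

lemma bruhat_step_less: "bruhat_step n x y \<Longrightarrow> bruhat_less n x y"
  unfolding bruhat_less_def bruhat_le_def
  by (metis bruhat_step_def less_irrefl r_into_rtranclp)

lemma bruhat_stepE:
  assumes "bruhat_step n x y"
  obtains a b where "x \<in> Sym n" "1 \<le> a" "a < b" "b \<le> n" "x a < x b" "y = x \<circ> transpose a b"
  using assms by (auto simp: bruhat_step_def len_transpose_iff)

lemma bruhat_steps_between:
  assumes "x \<in> Sym n" "1 \<le> a" "a < c" "c < b" "b \<le> n" "x a < x c" "x c < x b"
  defines "p \<equiv> x \<circ> transpose a c" and "q \<equiv> x \<circ> transpose a c \<circ> transpose a b"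
    and "y \<equiv> x \<circ> transpose a b"
  shows "bruhat_step n x p" "bruhat_step n p q" "bruhat_step n q y"
proof -
  note l = len_transpose_between[OF assms(2-7)]
  have p: "p \<in> Sym n" and q: "q \<in> Sym n"
    unfolding p_def q_def using assms by (auto intro!: Sym_transpose)
  show "bruhat_step n x p" "bruhat_step n p q"
    using assms(1-5) p l unfolding bruhat_step_def p_def q_def
    by (metis le_trans less_imp_le_nat less_trans)+
  have "y = q \<circ> transpose c b"
    using transpose_as_three_steps[OF assms(3,4), of x] by (simp add: y_def q_def)
  then show "bruhat_step n q y"
    using assms(1-5) q l unfolding bruhat_step_def y_def q_def
    by (metis le_trans less_imp_le_nat less_trans)
qed

lemma len_transpose_not_Suc:
  assumes "x \<in> Sym n" "1 \<le> a" "a < b" "b \<le> n" "x a < x b"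
    "len n (x \<circ> transpose a b) \<noteq> Suc (len n x)"
  obtains c where "a < c" "c < b" "x a < x c" "x c < x b"
  using len_transpose_Suc[of x a b n] assms Sym_inj by blast

text \<open>
  If the length jumps by more than one, then the factorisation of the transposition provides an
  element strictly in between.
\<close>

lemma bruhat_cover_iff:
  "bruhat_cover n x y \<longleftrightarrow> x \<in> Sym n \<and>
     (\<exists>a b. 1 \<le> a \<and> a < b \<and> b \<le> n \<and> y = x \<circ> transpose a b) \<and> len n y = Suc (len n x)"
    (is "?L \<longleftrightarrow> ?R")
proof
  assume ?R
  then have "bruhat_step n x y" by (auto simp: bruhat_step_def)
  moreover have "\<not> (bruhat_less n x v \<and> bruhat_less n v y)" for v
    using bruhat_less_len[of n x v] bruhat_less_len[of n v y] \<open>?R\<close> by auto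
  ultimately show ?L by (auto simp: bruhat_cover_def dest: bruhat_step_less)
next
  assume L: ?L
  then obtain v where v: "bruhat_step n x v" "(bruhat_step n)\<^sup>*\<^sup>* v y"
    by (auto simp: bruhat_cover_def bruhat_less_def bruhat_le_def elim: converse_rtranclpE)
  have "v = y"
  proof (rule ccontr)
    assume "v \<noteq> y"
    then have "bruhat_less n v y"
      using v bruhat_step_Sym by (auto simp: bruhat_less_def bruhat_le_def)
    with L v(1) show False by (auto simp: bruhat_cover_def dest: bruhat_step_less)
  qed
  with v obtain a b where ab: "x \<in> Sym n" "1 \<le> a" "a < b" "b \<le> n" "x a < x b"
    "y = x \<circ> transpose a b" by (auto elim: bruhat_stepE)
  have "len n y = Suc (len n x)"
  proof (rule ccontr)
    assume "len n y \<noteq> Suc (len n x)"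
    then obtain c where "a < c" "c < b" "x a < x c" "x c < x b"
      using len_transpose_not_Suc[of x n a b] ab by auto
    note st = bruhat_steps_between[OF ab(1,2) this(1,2) ab(4) this(3,4), folded ab(6)]
    then have s: "bruhat_step n x (x \<circ> transpose a c)"
      and t: "(bruhat_step n)\<^sup>*\<^sup>* (x \<circ> transpose a c) y" by simp_all
    have "len n (x \<circ> transpose a c) < len n y"
      using st(2,3) unfolding bruhat_step_def by linarith
    then have "bruhat_less n (x \<circ> transpose a c) y"
      using t bruhat_step_Sym[OF s] by (auto simp: bruhat_less_def bruhat_le_def)
    with s L show False by (auto simp: bruhat_cover_def dest: bruhat_step_less)
  qed
  with ab show ?R by auto
qed

text \<open>
  By induction on the length difference: the three factors of a step that is not a cover have
  smaller length differences.
\<close>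

lemma bruhat_step_covers:
  assumes "bruhat_step n x y"
  shows "(bruhat_cover n)\<^sup>*\<^sup>* x y"
  using assms
proof (induction "len n y - len n x" arbitrary: x y rule: less_induct)
  case less
  from less.prems obtain a b where ab: "x \<in> Sym n" "1 \<le> a" "a < b" "b \<le> n" "x a < x b"
    "y = x \<circ> transpose a b" by (auto elim: bruhat_stepE)
  show ?case
  proof (cases "len n y = Suc (len n x)")
    case True
    with ab have "bruhat_cover n x y" by (auto simp: bruhat_cover_iff)
    then show ?thesis by blast
  next
    case False
    then obtain c where c: "a < c" "c < b" "x a < x c" "x c < x b"
      using len_transpose_not_Suc[of x n a b] ab by auto
    define p where "p = x \<circ> transpose a c"
    define q where "q = x \<circ> transpose a c \<circ> transpose a b"
    have s: "bruhat_step n x p" "bruhat_step n p q" "bruhat_step n q y"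
      using bruhat_steps_between[OF ab(1,2) c(1,2) ab(4) c(3,4)] ab(6)
      unfolding p_def q_def by auto
    then have "len n x < len n p" "len n p < len n q" "len n q < len n y"
      by (auto simp: bruhat_step_def)
    then have "(bruhat_cover n)\<^sup>*\<^sup>* x p" "(bruhat_cover n)\<^sup>*\<^sup>* p q" "(bruhat_cover n)\<^sup>*\<^sup>* q y"
      using s by (auto intro!: less.hyps)
    then show ?thesis by auto
  qed
qed

lemma bruhat_cover_imp_step: "bruhat_cover n x y \<Longrightarrow> bruhat_step n x y"
  by (auto simp: bruhat_cover_iff bruhat_step_def)

lemma bruhat_le_iff_covers:
  "bruhat_le n x y \<longleftrightarrow> x \<in> Sym n \<and> (bruhat_cover n)\<^sup>*\<^sup>* x y"
proof -
  have "(bruhat_step n)\<^sup>*\<^sup>* x y \<Longrightarrow> (bruhat_cover n)\<^sup>*\<^sup>* x y"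
    by (induction rule: rtranclp_induct) (auto dest: bruhat_step_covers)
  moreover have "(bruhat_cover n)\<^sup>*\<^sup>* x y \<Longrightarrow> (bruhat_step n)\<^sup>*\<^sup>* x y"
    by (induction rule: rtranclp_induct)
      (auto dest: bruhat_cover_imp_step intro: rtranclp.rtrancl_into_rtrancl)
  ultimately show ?thesis by (auto simp: bruhat_le_def)
qed

lemma sigma_transpose_block:
  assumes "1 \<le> a" "1 \<le> b" "a \<le> k \<longleftrightarrow> b \<le> k"
  shows "sigma k (x \<circ> transpose a b) = sigma k x"
proof -
  have "transpose a b ` {1..k} = {1..k}" using assms by (intro transpose_image_eq) auto
  then show ?thesis unfolding sigma_def by (metis image_comp)
qed

lemma sigma_transpose_cross:
  assumes "inj x" "1 \<le> a" "a \<le> k" "k < b"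
  shows "sigma k (x \<circ> transpose a b) = insert (x b) (sigma k x - {x a})"
proof -
  have "{1..k} = insert a ({1..k} - {a})" using assms by auto
  then have "(x \<circ> transpose a b) ` {1..k} = insert (x b) ((x \<circ> transpose a b) ` ({1..k} - {a}))"
    by (metis image_insert comp_apply transpose_apply_first)
  also have "(x \<circ> transpose a b) ` ({1..k} - {a}) = x ` ({1..k} - {a})"
    using assms by (intro image_cong) (auto simp: transpose_def)
  also have "\<dots> = x ` {1..k} - {x a}"
    using assms by (auto simp: image_set_diff)
  finally show ?thesis by (simp add: sigma_def)
qed

lemma mem_sigma_iff: "inj x \<Longrightarrow> x i \<in> sigma k x \<longleftrightarrow> 1 \<le> i \<and> i \<le> k"
  by (auto simp: sigma_def inj_eq)

lemma k_bruhat_cover_iff: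
  "k_bruhat_cover k n x y \<longleftrightarrow> x \<in> Sym n \<and>
     (\<exists>a b. 1 \<le> a \<and> a \<le> k \<and> k < b \<and> b \<le> n \<and> y = x \<circ> transpose a b) \<and>
     len n y = Suc (len n x)" (is "?L \<longleftrightarrow> ?R")
proof
  assume L: ?L
  then obtain a b where ab: "x \<in> Sym n" "1 \<le> a" "a < b" "b \<le> n" "y = x \<circ> transpose a b"
    "len n y = Suc (len n x)" "sigma k x \<noteq> sigma k y"
    by (auto simp: k_bruhat_cover_def bruhat_cover_iff)
  then have "\<not> (a \<le> k \<longleftrightarrow> b \<le> k)" using sigma_transpose_block[of a b k x] by auto
  with ab have "a \<le> k" "k < b" by auto
  with ab show ?R by blast
next
  assume ?R
  then obtain a b where ab: "x \<in> Sym n" "1 \<le> a" "a \<le> k" "k < b" "b \<le> n"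
    "y = x \<circ> transpose a b" "len n y = Suc (len n x)"
    by auto
  note i = Sym_inj[OF ab(1)]
  have "x b \<notin> sigma k x" using mem_sigma_iff[OF i, of b k] ab by auto
  then have "sigma k x \<noteq> sigma k y" using sigma_transpose_cross[OF i ab(2-4)] ab by auto
  moreover have "a < b" using ab by simp
  ultimately show ?L using ab unfolding k_bruhat_cover_def bruhat_cover_iff by blast
qed

text \<open>
  The Bruhat covers that are not \<open>k\<close>-Bruhat covers. They transpose two positions of the same
  block \<open>{1..k}\<close> or \<open>{k<..n}\<close>.
\<close>

definition block_cover :: "nat \<Rightarrow> nat \<Rightarrow> (nat \<Rightarrow> nat) \<Rightarrow> (nat \<Rightarrow> nat) \<Rightarrow> bool" where
  "block_cover k n x y \<longleftrightarrow> bruhat_cover n x y \<and> sigma k x = sigma k y"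

definition same_block :: "nat \<Rightarrow> nat \<Rightarrow> nat \<Rightarrow> nat \<Rightarrow> bool" where
  "same_block k n a b \<longleftrightarrow> 1 \<le> a \<and> a < b \<and> b \<le> n \<and> (b \<le> k \<or> k < a)"

lemma block_cover_iff:
  "block_cover k n x y \<longleftrightarrow> x \<in> Sym n \<and>
     (\<exists>a b. same_block k n a b \<and> y = x \<circ> transpose a b) \<and> len n y = Suc (len n x)"
    (is "?L \<longleftrightarrow> ?R")
proof
  assume L: ?L
  then obtain a b where ab: "x \<in> Sym n" "1 \<le> a" "a < b" "b \<le> n" "y = x \<circ> transpose a b"
    "len n y = Suc (len n x)" "sigma k x = sigma k y"
    by (auto simp: block_cover_def bruhat_cover_iff)
  have "\<not> k_bruhat_cover k n x y" using ab by (simp add: k_bruhat_cover_def)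
  then have "\<not> (a \<le> k \<and> k < b)" using ab unfolding k_bruhat_cover_iff by blast
  with ab have "same_block k n a b" by (auto simp: same_block_def)
  with ab show ?R by blast
next
  assume ?R
  then obtain a b where ab: "x \<in> Sym n" "same_block k n a b" "y = x \<circ> transpose a b"
    "len n y = Suc (len n x)" by auto
  then have "sigma k y = sigma k x"
    using sigma_transpose_block[of a b k x] by (auto simp: same_block_def)
  moreover have "1 \<le> a" "a < b" "b \<le> n" using ab by (auto simp: same_block_def)
  ultimately show ?L using ab unfolding block_cover_def bruhat_cover_iff by blast
qed

lemma bruhat_cover_cases: "bruhat_cover n x y \<longleftrightarrow> k_bruhat_cover k n x y \<or> block_cover k n x y"
  by (auto simp: k_bruhat_cover_def block_cover_def)

lemma k_bruhat_coverE:
  assumes "k_bruhat_cover k n x y"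
  obtains a b where "x \<in> Sym n" "y \<in> Sym n" "1 \<le> a" "a \<le> k" "k < b" "b \<le> n"
    "y = x \<circ> transpose a b" "len n y = Suc (len n x)" "x a < x b"
    "\<And>c. a < c \<Longrightarrow> c < b \<Longrightarrow> \<not> (x a < x c \<and> x c < x b)"
    "sigma k y = insert (x b) (sigma k x - {x a})" "x a \<in> sigma k x" "x b \<notin> sigma k x"
proof -
  obtain a b where ab: "x \<in> Sym n" "1 \<le> a" "a \<le> k" "k < b" "b \<le> n"
    "y = x \<circ> transpose a b" "len n y = Suc (len n x)"
    using assms unfolding k_bruhat_cover_iff by blast
  note i = Sym_inj[OF ab(1)]
  have less: "x a < x b" using len_transpose_iff[of x n a b] ab by auto
  have "\<not> (x a < x c \<and> x c < x b)" if "a < c" "c < b" for c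
    using len_transpose_between[of a c b n x] that ab by fastforce
  moreover have "y \<in> Sym n" using ab by (auto intro: Sym_transpose)
  ultimately show ?thesis
    using that[of a b] ab less sigma_transpose_cross[OF i ab(2-4)] mem_sigma_iff[OF i] by auto
qed

lemma k_bruhat_coverI:
  assumes "x \<in> Sym n" "1 \<le> a" "a \<le> k" "k < b" "b \<le> n" "x a < x b"
    "len n (x \<circ> transpose a b) \<le> Suc (len n x)"
  shows "k_bruhat_cover k n x (x \<circ> transpose a b)"
proof -
  have "len n x < len n (x \<circ> transpose a b)" using assms by (intro len_less_transpose) auto
  then show ?thesis using assms by (auto simp: k_bruhat_cover_iff)
qed

lemma block_coverE:
  assumes "block_cover k n x y"
  obtains a b where "x \<in> Sym n" "y \<in> Sym n" "same_block k n a b"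
    "y = x \<circ> transpose a b" "len n y = Suc (len n x)" "x a < x b"
proof -
  obtain a b where ab: "x \<in> Sym n" "same_block k n a b"
    "y = x \<circ> transpose a b" "len n y = Suc (len n x)"
    using assms unfolding block_cover_iff by blast
  then have "x a < x b" using len_transpose_iff[of x n a b] by (auto simp: same_block_def)
  moreover have "y \<in> Sym n" using ab by (auto intro: Sym_transpose simp: same_block_def)
  ultimately show ?thesis using that[of a b] ab by blast
qed

lemma block_coverI:
  assumes "x \<in> Sym n" "same_block k n a b" "x a < x b"
    "len n (x \<circ> transpose a b) \<le> Suc (len n x)"
  shows "block_cover k n x (x \<circ> transpose a b)"
proof -
  have "len n x < len n (x \<circ> transpose a b)"
    using assms by (intro len_less_transpose) (auto simp: same_block_def)
  then show ?thesis using assms by (auto simp: block_cover_iff)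
qed

section \<open>Moving block covers behind k-Bruhat covers\<close>

lemma conj_transpose:
  "x \<circ> transpose a b \<circ> transpose c d
    = x \<circ> transpose (transpose a b c) (transpose a b d) \<circ> transpose a b"
  by (auto simp: fun_eq_iff transpose_def)

text \<open>
  Each exchange adds at least one inversion, so a total of two forces each to be a cover.
\<close>

lemma two_k_covers:
  assumes "x \<in> Sym n" and ab: "1 \<le> a" "a \<le> k" "k < b" "b \<le> n" and "x a < x b"
    and m: "m = x \<circ> transpose a b"
    and cd: "1 \<le> c" "c \<le> k" "k < d" "d \<le> n" and "m c < m d"
    and y: "y = m \<circ> transpose c d" and "len n y = Suc (Suc (len n x))"
  shows "k_bruhat_cover k n x m \<and> k_bruhat_cover k n m y"
proof -
  have "len n x < len n m" unfolding m using assms by (intro len_less_transpose) auto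
  moreover have "len n m < len n y" unfolding y using assms(8-12) by (intro len_less_transpose) auto
  moreover have "m \<in> Sym n" unfolding m using assms(1-5) by (intro Sym_transpose) auto
  ultimately show ?thesis
    using k_bruhat_coverI[OF assms(1) ab assms(6), folded m] k_bruhat_coverI[OF _ cd assms(12), folded y]
      assms(14) by simp
qed

text \<open>
  Conjugating the exchange by the block transposition gives a candidate \<open>v\<close> for \<open>y\<close> from which the
  block transposition leads to \<open>q'\<close>. This step is a block cover unless it decreases the length;
  in that exceptional case \<open>p\<close> and \<open>q'\<close> are also joined by two \<open>k\<close>-Bruhat covers. In both cases
  no image is lost: \<open>p\<close> and \<open>q\<close> have the same image, and if \<open>y\<close> to \<open>q'\<close> is a block cover then so
  do \<open>y\<close> and \<open>q'\<close>.
\<close>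

lemma block_then_k_cover:
  assumes "block_cover k n p q" "k_bruhat_cover k n q q'"
  shows "\<exists>y. k_bruhat_cover k n p y \<and> (block_cover k n y q' \<or> k_bruhat_cover k n y q')"
proof -
  obtain x y where xy: "p \<in> Sym n" "q \<in> Sym n" "same_block k n x y" "q = p \<circ> transpose x y"
    "len n q = Suc (len n p)" "p x < p y"
    using assms(1) by (rule block_coverE)
  obtain a b where ab: "1 \<le> a" "a \<le> k" "k < b" "b \<le> n" "q' = q \<circ> transpose a b"
    "len n q' = Suc (len n q)" "q a < q b"
    using assms(2) by (rule k_bruhat_coverE)
  define a' where "a' = transpose x y a"
  define b' where "b' = transpose x y b"
  define v where "v = p \<circ> transpose a' b'"
  have ab': "1 \<le> a'" "a' \<le> k" "k < b'" "b' \<le> n"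
    using ab xy(3) by (auto simp: a'_def b'_def same_block_def transpose_def)
  have pab: "p a' < p b'" using ab(7) xy(4) by (simp add: a'_def b'_def)
  have q': "q' = v \<circ> transpose x y"
    unfolding ab(5) xy(4) v_def a'_def b'_def by (rule conj_transpose)
  have v: "v \<in> Sym n" unfolding v_def using ab' xy(1) by (intro Sym_transpose) auto
  have l2: "len n q' = Suc (Suc (len n p))" using xy(5) ab(6) by simp
  show ?thesis
  proof (cases "v x < v y")
    case True
    then have "len n v < len n q'"
      unfolding q' using xy(3) by (intro len_less_transpose) (auto simp: same_block_def)
    moreover have "len n p < len n v"
      unfolding v_def using ab' pab by (intro len_less_transpose) auto
    ultimately have "len n v \<le> Suc (len n p)" "len n q' \<le> Suc (len n v)" using l2 by simp_all
    then have "k_bruhat_cover k n p v" "block_cover k n v q'"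
      using k_bruhat_coverI[OF xy(1) ab' pab, folded v_def] block_coverI[OF v xy(3) True, folded q']
      by simp_all
    then show ?thesis by blast
  next
    case False
    have "v x \<noteq> v y" using Sym_inj[OF v] xy(3) by (auto simp: inj_eq same_block_def)
    with False have "v y < v x" by auto
    then have less: "q' x < q' y" by (simp add: q')
    have gr: "q y < q x" using xy by simp
    \<comment> \<open>The exchange undoes the inversion that the block cover created, so it replaces the value at
      \<open>y\<close> by one above \<open>q x\<close>, or the value at \<open>x\<close> by one below \<open>q y\<close>. The resulting order of the three
      values also arises by two exchanges across the cut at \<open>k\<close>.\<close>
    consider "y \<le> k" "a = y" | "k < x" "b = x"
      using less gr xy(3) ab by (auto simp: same_block_def transpose_def split: if_splits)
    then show ?thesis
    proof cases
      case 1
      let ?m = "p \<circ> transpose y b"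
      have x: "1 \<le> x" "x < y" "x \<noteq> b" "y \<noteq> b" "x \<noteq> y" using xy(3) 1 ab by (auto simp: same_block_def)
      have bd: "1 \<le> y" "y \<le> k" "k < b" "b \<le> n" "1 \<le> x" "x \<le> k" "k < b" "b \<le> n"
        using x ab(1-4) 1 by simp_all
      have e: "q' = ?m \<circ> transpose x b"
        unfolding ab(5) xy(4) 1 using x by (auto simp: fun_eq_iff transpose_def)
      have l: "p y < p b" "?m x < ?m b"
        using less gr x 1 ab xy(4) by (auto simp: transpose_def split: if_splits)
      show ?thesis
        using two_k_covers[OF xy(1) bd(1-4) l(1) refl bd(5-8) l(2) e l2] by blast
    next
      case 2
      let ?m = "p \<circ> transpose a x"
      have x: "x < y" "y \<le> n" "x \<noteq> a" "y \<noteq> a" "x \<noteq> y" using xy(3) 2 ab by (auto simp: same_block_def)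
      have bd: "1 \<le> a" "a \<le> k" "k < x" "x \<le> n" "1 \<le> a" "a \<le> k" "k < y" "y \<le> n"
        using x ab(1-4) 2 by simp_all
      have e: "q' = ?m \<circ> transpose a y"
        unfolding ab(5) xy(4) 2 using x by (auto simp: fun_eq_iff transpose_def)
      have l: "p a < p x" "?m a < ?m y"
        using less gr x 2 ab xy(4) by (auto simp: transpose_def split: if_splits)
      show ?thesis
        using two_k_covers[OF xy(1) bd(1-4) l(1) refl bd(5-8) l(2) e l2] by blast
    qed
  qed
qed

text \<open>
  Only the set \<open>F\<close> of images of a chain from \<open>u\<close> to \<open>w\<close> is recorded, since the arguments that rewrite
  a chain step by step merely have to keep track of a lower bound on its image.
\<close>

inductive chain_image ::
    "nat \<Rightarrow> ((nat \<Rightarrow> nat) \<Rightarrow> (nat \<Rightarrow> nat) \<Rightarrow> bool) \<Rightarrow> (nat \<Rightarrow> nat) \<Rightarrow> nat set set \<Rightarrow> (nat \<Rightarrow> nat) \<Rightarrow> bool"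
  for k R u where
  start: "chain_image k R u {sigma k u} u"
| step: "chain_image k R u F v \<Longrightarrow> R v w \<Longrightarrow> chain_image k R u (insert (sigma k w) F) w"

abbreviation k_chain :: "nat \<Rightarrow> nat \<Rightarrow> (nat \<Rightarrow> nat) \<Rightarrow> nat set set \<Rightarrow> (nat \<Rightarrow> nat) \<Rightarrow> bool" where
  "k_chain k n \<equiv> chain_image k (k_bruhat_cover k n)"

lemma chain_image_ends: "chain_image k R u F w \<Longrightarrow> sigma k u \<in> F \<and> sigma k w \<in> F"
  by (induction rule: chain_image.induct) auto

lemma chain_image_append:
  assumes "chain_image k R v F' w" "chain_image k R u F v"
  shows "chain_image k R u (F \<union> F') w"
  using assms
proof (induction rule: chain_image.induct)
  case start
  then have "F \<union> {sigma k v} = F" using chain_image_ends by auto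
  with start show ?case by simp
next
  case (step F' v' w)
  then show ?case using chain_image.step[of k R u "F \<union> F'" v' w] by simp
qed

lemma chain_image_rtranclp: "chain_image k R u F w \<Longrightarrow> R\<^sup>*\<^sup>* u w"
  by (induction rule: chain_image.induct) auto

lemma rtranclp_chain_image: "R\<^sup>*\<^sup>* u w \<Longrightarrow> \<exists>F. chain_image k R u F w"
proof (induction rule: rtranclp_induct)
  case base
  show ?case using chain_image.start by blast
next
  case (step v w)
  then show ?case using chain_image.step by blast
qed

lemma k_chain_start: "k_chain k n u {sigma k u} u"
  by (rule chain_image.start)

lemma k_chain_step:
  "k_chain k n u F v \<Longrightarrow> k_bruhat_cover k n v w \<Longrightarrow> k_chain k n u (insert (sigma k w) F) w"
  by (erule chain_image.step)

text \<open>
  The block cover either survives to the top of the chain or is absorbed on the way, which makes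
  the \<open>k\<close>-Bruhat chain one step longer.
\<close>

lemma block_past_k_chain:
  assumes "k_chain k n q F v" "block_cover k n p q"
  shows "\<exists>v' F'. F \<subseteq> F' \<and> k_chain k n p F' v' \<and> (v' = v \<or> block_cover k n v' v)"
  using assms
proof (induction rule: chain_image.induct)
  case start
  then have "sigma k p = sigma k q" by (simp add: block_cover_def)
  then have "k_chain k n p {sigma k q} p" using k_chain_start[of k n p] by simp
  with start show ?case by (intro exI[of _ p] exI[of _ "{sigma k q}"]) simp
next
  case (step F v w)
  obtain v' F' where F': "F \<subseteq> F'" "k_chain k n p F' v'" "v' = v \<or> block_cover k n v' v"
    using step.IH[OF step.prems] by metis
  from F'(3) show ?case
  proof
    assume "v' = v"
    then have "k_chain k n p (insert (sigma k w) F') w"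
      using k_chain_step[OF F'(2)] step.hyps(2) by simp
    moreover have "insert (sigma k w) F \<subseteq> insert (sigma k w) F'" using F'(1) by auto
    ultimately show ?thesis by (intro exI[of _ w] exI[of _ "insert (sigma k w) F'"] conjI disjI1 refl)
  next
    assume "block_cover k n v' v"
    then obtain y where y: "k_bruhat_cover k n v' y" "block_cover k n y w \<or> k_bruhat_cover k n y w"
      using block_then_k_cover[OF _ step.hyps(2)] by metis
    have c: "k_chain k n p (insert (sigma k y) F') y"
      by (rule k_chain_step[OF F'(2) y(1)])
    from y(2) show ?thesis
    proof
      assume b: "block_cover k n y w"
      then have "sigma k y = sigma k w" by (simp add: block_cover_def)
      then have "insert (sigma k w) F \<subseteq> insert (sigma k y) F'" using F'(1) by auto
      with b c show ?thesis
        by (intro exI[of _ y] exI[of _ "insert (sigma k y) F'"] conjI disjI2)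
    next
      assume y': "k_bruhat_cover k n y w"
      have "k_chain k n p (insert (sigma k w) (insert (sigma k y) F')) w"
        by (rule k_chain_step[OF c y'])
      moreover have "insert (sigma k w) F \<subseteq> insert (sigma k w) (insert (sigma k y) F')"
        using F'(1) by auto
      ultimately show ?thesis
        by (intro exI[of _ w] exI[of _ "insert (sigma k w) (insert (sigma k y) F')"] conjI disjI1 refl)
    qed
  qed
qed

lemma blocks_then_k_cover:
  assumes "(block_cover k n)\<^sup>*\<^sup>* x v" "k_bruhat_cover k n v w"
  shows "\<exists>x' F. sigma k w \<in> F \<and> k_chain k n x F x' \<and> (block_cover k n)\<^sup>*\<^sup>* x' w"
  using assms(1)
proof (induction rule: converse_rtranclp_induct)
  case base
  have "k_chain k n v {sigma k v} v" by (rule k_chain_start)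
  from k_chain_step[OF this assms(2)]
  have "k_chain k n v (insert (sigma k w) {sigma k v}) w" .
  then show ?case by blast
next
  case (step x x1)
  then obtain x' F where F: "sigma k w \<in> F" "k_chain k n x1 F x'" "(block_cover k n)\<^sup>*\<^sup>* x' w"
    by blast
  obtain v' F' where F': "F \<subseteq> F'" "k_chain k n x F' v'" "v' = x' \<or> block_cover k n v' x'"
    using block_past_k_chain[OF F(2) step.hyps(1)] by blast
  then have "(block_cover k n)\<^sup>*\<^sup>* v' w" using F(3) by (auto intro: converse_rtranclp_into_rtranclp)
  with F F' show ?case by blast
qed

text \<open>
  Bubble sort: every block cover is moved behind all \<open>k\<close>-Bruhat covers, and the image only grows.
\<close>

lemma bruhat_chain_k_then_block:
  assumes "chain_image k (bruhat_cover n) u F w"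
  shows "\<exists>x F'. F \<subseteq> F' \<and> k_chain k n u F' x \<and> (block_cover k n)\<^sup>*\<^sup>* x w"
  using assms
proof (induction rule: chain_image.induct)
  case start
  have "k_chain k n u {sigma k u} u" by (rule k_chain_start)
  then show ?case by blast
next
  case (step F v w)
  then obtain x F' where F': "F \<subseteq> F'" "k_chain k n u F' x" "(block_cover k n)\<^sup>*\<^sup>* x v" by blast
  from step.hyps(2) have "k_bruhat_cover k n v w \<or> block_cover k n v w"
    using bruhat_cover_cases by blast
  then show ?case
  proof
    assume "block_cover k n v w"
    then have "(block_cover k n)\<^sup>*\<^sup>* x w" using F'(3) by simp
    moreover have "sigma k x = sigma k v"
      using F'(3) by (induction rule: rtranclp_induct) (auto simp: block_cover_def)
    moreover have "sigma k w \<in> F'"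
      using \<open>block_cover k n v w\<close> calculation(2) chain_image_ends[OF F'(2)]
      by (simp add: block_cover_def)
    ultimately show ?thesis using F' by blast
  next
    assume "k_bruhat_cover k n v w"
    then obtain x' G where G: "sigma k w \<in> G" "k_chain k n x G x'" "(block_cover k n)\<^sup>*\<^sup>* x' w"
      using blocks_then_k_cover[OF F'(3)] by blast
    have "k_chain k n u (F' \<union> G) x'" by (rule chain_image_append[OF G(2) F'(2)])
    moreover have "insert (sigma k w) F \<subseteq> F' \<union> G" using F'(1) G(1) by auto
    ultimately show ?thesis using G(3) by blast
  qed
qed

section \<open>Translation by block-preserving permutations\<close>

lemma Sym_comp: "x \<in> Sym n \<Longrightarrow> z \<in> Sym n \<Longrightarrow> x \<circ> z \<in> Sym n"
  by (simp add: Sym_def permutes_compose)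

lemma parabolic_Sym: "z \<in> parabolic k n \<Longrightarrow> z \<in> Sym n"
  by (simp add: parabolic_def)

lemma sigma_comp_parabolic: "z \<in> parabolic k n \<Longrightarrow> sigma k (x \<circ> z) = sigma k x"
  unfolding sigma_def parabolic_def by (metis (mono_tags, lifting) image_comp mem_Collect_eq)

lemma parabolic_comp: "z \<in> parabolic k n \<Longrightarrow> z' \<in> parabolic k n \<Longrightarrow> z \<circ> z' \<in> parabolic k n"
  unfolding parabolic_def by (metis (mono_tags, lifting) Sym_comp image_comp mem_Collect_eq)

lemma parabolic_inv:
  assumes "z \<in> parabolic k n"
  shows "inv z \<in> parabolic k n" "x \<circ> z \<circ> inv z = x"
proof -
  have z: "z permutes {1..n}" "z ` {1..k} = {1..k}" using assms by (auto simp: parabolic_def Sym_def)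
  have "inv z ` (z ` {1..k}) = {1..k}"
    using permutes_inj[OF z(1)] by (simp add: image_inv_f_f)
  then show "inv z \<in> parabolic k n"
    using z permutes_inv[OF z(1)] by (simp add: parabolic_def Sym_def)
  show "x \<circ> z \<circ> inv z = x"
    using permutes_surj[OF z(1)] by (simp add: comp_assoc surj_iff)
qed

lemma id_parabolic: "id \<in> parabolic k n"
  by (simp add: parabolic_def Sym_def permutes_id)

lemma transpose_parabolic: "same_block k n a b \<Longrightarrow> transpose a b \<in> parabolic k n"
  unfolding parabolic_def Sym_def same_block_def
  by (auto intro!: permutes_swap_id transpose_image_eq simp del: transpose_image_eq)

lemma k_cover_twist:
  assumes "k_bruhat_cover k n x y" "z \<in> parabolic k n"
  shows "len n (x \<circ> z) < len n (y \<circ> z)"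
    "len n (y \<circ> z) \<le> Suc (len n (x \<circ> z)) \<Longrightarrow> k_bruhat_cover k n (x \<circ> z) (y \<circ> z)"
proof -
  obtain a b where ab: "x \<in> Sym n" "1 \<le> a" "a \<le> k" "k < b" "b \<le> n"
    "y = x \<circ> transpose a b" "x a < x b"
    using assms(1) by (rule k_bruhat_coverE)
  have z: "z permutes {1..n}" "z ` {1..k} = {1..k}"
    using assms(2) by (auto simp: parabolic_def Sym_def)
  have "a \<in> z ` {1..k}" unfolding z(2) using ab by simp
  then obtain a' where a': "a = z a'" "1 \<le> a'" "a' \<le> k" by auto
  have "b \<in> z ` {1..n}" using permutes_image[OF z(1)] ab by simp
  then obtain b' where b': "b = z b'" "1 \<le> b'" "b' \<le> n" by auto
  have "k < b'"
  proof (rule ccontr)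
    assume "\<not> k < b'"
    then have "z b' \<in> z ` {1..k}" using b' by auto
    then show False unfolding z(2) using b' ab by simp
  qed
  have e: "y \<circ> z = x \<circ> z \<circ> transpose a' b'"
    unfolding ab(6) a' b' using permutes_inj[OF z(1)]
    by (auto simp: fun_eq_iff transpose_def inj_eq)
  have l: "(x \<circ> z) a' < (x \<circ> z) b'" using ab(7) by (simp add: a' b')
  show "len n (x \<circ> z) < len n (y \<circ> z)"
    unfolding e using l a' b' \<open>k < b'\<close> by (intro len_less_transpose) auto
  have s: "x \<circ> z \<in> Sym n" using ab(1) assms(2) by (auto intro: Sym_comp parabolic_Sym)
  show "k_bruhat_cover k n (x \<circ> z) (y \<circ> z)" if "len n (y \<circ> z) \<le> Suc (len n (x \<circ> z))"
    using k_bruhat_coverI[of "x \<circ> z", OF s a'(2,3) \<open>k < b'\<close> b'(3) l] that unfolding e by simp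
qed

lemma k_cover_len: "k_bruhat_cover k n x y \<Longrightarrow> len n y = Suc (len n x)"
  by (auto simp: k_bruhat_cover_iff)

lemma k_chain_twist_len:
  assumes "k_chain k n u F w" "z \<in> parabolic k n"
  shows "len n (u \<circ> z) + len n w \<le> len n (w \<circ> z) + len n u"
  using assms(1)
proof (induction rule: chain_image.induct)
  case (step F v w)
  then show ?case using k_cover_twist(1)[OF step.hyps(2) assms(2)] k_cover_len[OF step.hyps(2)]
    by linarith
qed simp

text \<open>
  Translation by \<open>z\<close> keeps all images and turns each \<open>k\<close>-Bruhat cover into an exchange that
  increases the length, by at least one. If the total increase is the number of steps, then each
  translated step is again a cover.
\<close>

lemma k_chain_twist:
  assumes "k_chain k n u F w" "z \<in> parabolic k n"
    and "len n (w \<circ> z) + len n u = len n (u \<circ> z) + len n w"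
  shows "k_chain k n (u \<circ> z) F (w \<circ> z)"
  using assms(1,3)
proof (induction rule: chain_image.induct)
  case start
  show ?case using k_chain_start[of k n "u \<circ> z"] unfolding sigma_comp_parabolic[OF assms(2)] .
next
  case (step F v w)
  note l = k_chain_twist_len[OF step.hyps(1) assms(2)] k_cover_twist[OF step.hyps(2) assms(2)]
    k_cover_len[OF step.hyps(2)]
  have "k_chain k n (u \<circ> z) F (v \<circ> z)" using l(1,2,4) step.prems by (intro step.IH) linarith
  moreover have "k_bruhat_cover k n (v \<circ> z) (w \<circ> z)" using l(1,2,4) step.prems by (intro l(3)) linarith
  ultimately have "k_chain k n (u \<circ> z) (insert (sigma k (w \<circ> z)) F) (w \<circ> z)" by (rule k_chain_step)
  then show ?case unfolding sigma_comp_parabolic[OF assms(2)] .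
qed

lemma k_chain_twist_iff:
  assumes z: "z \<in> parabolic k n"
    and l: "len n (w \<circ> z) + len n u = len n (u \<circ> z) + len n w"
  shows "k_chain k n (u \<circ> z) F (w \<circ> z) \<longleftrightarrow> k_chain k n u F w"
proof
  note z' = parabolic_inv[OF z]
  assume c: "k_chain k n (u \<circ> z) F (w \<circ> z)"
  have "k_chain k n (u \<circ> z \<circ> inv z) F (w \<circ> z \<circ> inv z)"
    by (rule k_chain_twist[OF c z'(1)]) (use l in \<open>simp add: z'(2)\<close>)
  then show "k_chain k n u F w" unfolding z'(2) .
qed (rule k_chain_twist[OF _ z l])

section \<open>Every face lies in a top face\<close>

text \<open>
  An exchange that destroyed the ascent at \<open>a < b\<close> would have to pass over a position whose value
  lies strictly between the exchanged values, and would not be a cover. Hence inside a block only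
  the inversions that \<open>u\<close> already has can survive along a \<open>k\<close>-Bruhat chain from \<open>u\<close>.
\<close>

lemma k_cover_block_ascent:
  assumes "k_bruhat_cover k n x y" "same_block k n a b" "x a < x b"
  shows "y a < y b"
proof -
  obtain c d where cd: "x \<in> Sym n" "c \<le> k" "k < d" "y = x \<circ> transpose c d" "x c < x d"
    and gap: "\<And>i. c < i \<Longrightarrow> i < d \<Longrightarrow> \<not> (x c < x i \<and> x i < x d)"
    using assms(1) by (rule k_bruhat_coverE) blast
  have i: "x i = x j \<longleftrightarrow> i = j" for i j using Sym_inj[OF cd(1)] by (simp add: inj_eq)
  consider "b \<le> k" | "k < a" using assms(2) by (auto simp: same_block_def)
  then show ?thesis
  proof cases
    case 1
    have "a < b" using assms(2) by (simp add: same_block_def)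
    have "x d < x b" if "a = c"
      using gap[of b] that i[of b d] assms(3) cd 1 \<open>a < b\<close> by auto
    then show ?thesis using 1 \<open>a < b\<close> assms(3) cd by (auto simp: transpose_def)
  next
    case 2
    have "a < b" using assms(2) by (simp add: same_block_def)
    have "x a < x c" if "b = d"
      using gap[of a] that i[of a c] assms(3) cd 2 \<open>a < b\<close> by auto
    then show ?thesis using 2 \<open>a < b\<close> assms(3) cd by (auto simp: transpose_def)
  qed
qed

lemma k_chain_block_ascent:
  assumes "k_chain k n u F w" "same_block k n a b" "u a < u b"
  shows "w a < w b"
  using assms(1,3) by (induction rule: chain_image.induct) (auto dest: k_cover_block_ascent[OF _ assms(2)])

lemma k_chain_Sym: "k_chain k n u F w \<Longrightarrow> u \<in> Sym n \<Longrightarrow> w \<in> Sym n"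
  by (induction rule: chain_image.induct) (auto elim: k_bruhat_coverE)

lemma k_chain_len: "k_chain k n u F w \<Longrightarrow> len n u \<le> len n w"
  by (induction rule: chain_image.induct) (auto dest: k_cover_len)

lemma len_simple_up:
  assumes "x \<in> Sym n" "same_block k n i (Suc i)" "x i < x (Suc i)"
  shows "len n (x \<circ> transpose i (Suc i)) = Suc (len n x)"
  using assms by (intro len_transpose_Suc Sym_inj) (auto simp: same_block_def)

lemma len_simple_down:
  assumes "x \<in> Sym n" "same_block k n i (Suc i)" "x (Suc i) < x i"
  shows "Suc (len n (x \<circ> transpose i (Suc i))) = len n x"
proof -
  let ?s = "transpose i (Suc i)"
  have "x \<circ> ?s \<in> Sym n" using assms by (intro Sym_transpose) (auto simp: same_block_def)
  then have "len n (x \<circ> ?s \<circ> ?s) = Suc (len n (x \<circ> ?s))"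
    using assms by (intro len_simple_up) auto
  then show ?thesis by simp
qed

text \<open>
  The mirror image of the exceptional case of \<open>block_then_k_cover\<close>, for a simple transposition:
  an exchange removes the descent of \<open>p\<close> at \<open>i\<close> and the simple transposition restores it.
\<close>

lemma k_cover_then_simple:
  assumes "k_bruhat_cover k n p q" and i: "same_block k n i (Suc i)"
    and "p (Suc i) < p i" "q i < q (Suc i)"
  shows "\<exists>m. k_bruhat_cover k n p m \<and> k_bruhat_cover k n m (q \<circ> transpose i (Suc i))"
proof -
  obtain a b where ab: "p \<in> Sym n" "q \<in> Sym n" "1 \<le> a" "a \<le> k" "k < b" "b \<le> n"
    "q = p \<circ> transpose a b" "len n q = Suc (len n p)" "p a < p b"
    using assms(1) by (rule k_bruhat_coverE)
  have l: "len n (q \<circ> transpose i (Suc i)) = Suc (Suc (len n p))"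
    using len_simple_up[OF ab(2) i assms(4)] ab(8) by simp
  have bd: "1 \<le> i" "Suc i \<le> n" using i by (auto simp: same_block_def)
  consider "Suc i \<le> k" "a = Suc i" | "k < i" "b = i"
    using assms(2-4) ab by (auto simp: same_block_def transpose_def split: if_splits)
  then show ?thesis
  proof cases
    case 1
    let ?m = "p \<circ> transpose i b"
    have "k_bruhat_cover k n p ?m \<and> k_bruhat_cover k n ?m (q \<circ> transpose i (Suc i))"
    proof (rule two_k_covers[where a = i and b = b and c = "Suc i" and d = b])
      show "q \<circ> transpose i (Suc i) = ?m \<circ> transpose (Suc i) b"
        unfolding ab(7) 1 using 1 ab(5) by (auto simp: fun_eq_iff transpose_def)
    qed (use 1 ab bd l assms(3,4) in \<open>auto simp: transpose_def split: if_splits\<close>)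
    then show ?thesis by blast
  next
    case 2
    let ?m = "p \<circ> transpose a (Suc i)"
    have "k_bruhat_cover k n p ?m \<and> k_bruhat_cover k n ?m (q \<circ> transpose i (Suc i))"
    proof (rule two_k_covers[where a = a and b = "Suc i" and c = a and d = i])
      show "q \<circ> transpose i (Suc i) = ?m \<circ> transpose a i"
        unfolding ab(7) 2 using 2 ab(4) by (auto simp: fun_eq_iff transpose_def)
    qed (use 2 ab bd l assms(3,4) in \<open>auto simp: transpose_def split: if_splits\<close>)
    then show ?thesis by blast
  qed
qed

text \<open>
  Since \<open>u\<close> has a descent at \<open>i\<close> and \<open>x\<close> has none, some cover of the chain removes it. After this
  cover the chain is translated by the simple transposition, and the cover itself is replaced by
  two.
\<close>

lemma k_chain_then_simple:
  assumes "k_chain k n u F x" "u \<in> Sym n" and i: "same_block k n i (Suc i)"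
    and "u (Suc i) < u i" "x i < x (Suc i)"
  shows "\<exists>F'. F \<subseteq> F' \<and> k_chain k n u F' (x \<circ> transpose i (Suc i))"
  using assms(1,5)
proof (induction rule: chain_image.induct)
  case start
  with assms(4) show ?case by simp
next
  case (step F v w)
  let ?s = "transpose i (Suc i)"
  have s: "?s \<in> parabolic k n" using i by (rule transpose_parabolic)
  have v: "v \<in> Sym n" using k_chain_Sym[OF step.hyps(1) assms(2)] .
  have w: "w \<in> Sym n" using step.hyps(2) by (auto elim: k_bruhat_coverE)
  have "v i \<noteq> v (Suc i)" using Sym_inj[OF v] by (simp add: inj_eq)
  then consider "v i < v (Suc i)" | "v (Suc i) < v i" by linarith
  then show ?case
  proof cases
    case 1
    then obtain F' where F': "F \<subseteq> F'" "k_chain k n u F' (v \<circ> ?s)" using step.IH by blast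
    have "k_bruhat_cover k n (v \<circ> ?s) (w \<circ> ?s)"
      using len_simple_up[OF v i 1] len_simple_up[OF w i step.prems] k_cover_len[OF step.hyps(2)]
      by (intro k_cover_twist(2)[OF step.hyps(2) s]) simp
    from k_chain_step[OF F'(2) this]
    have "k_chain k n u (insert (sigma k w) F') (w \<circ> ?s)"
      unfolding sigma_comp_parabolic[OF s] .
    moreover have "insert (sigma k w) F \<subseteq> insert (sigma k w) F'" using F'(1) by auto
    ultimately show ?thesis by (intro exI conjI)
  next
    case 2
    obtain m where m: "k_bruhat_cover k n v m" "k_bruhat_cover k n m (w \<circ> ?s)"
      using k_cover_then_simple[OF step.hyps(2) i 2 step.prems] by blast
    from k_chain_step[OF k_chain_step[OF step.hyps(1) m(1)] m(2)]
    have "k_chain k n u (insert (sigma k w) (insert (sigma k m) F)) (w \<circ> ?s)"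
      unfolding sigma_comp_parabolic[OF s] .
    moreover have "insert (sigma k w) F \<subseteq> insert (sigma k w) (insert (sigma k m) F)" by auto
    ultimately show ?thesis by (intro exI conjI)
  qed
qed

text \<open>
  The Bruhat order inside the cosets of \<^term>\<open>parabolic k n\<close>. Steps of arbitrary length are
  allowed because the lifting property does not preserve covers.
\<close>

definition block_step :: "nat \<Rightarrow> nat \<Rightarrow> (nat \<Rightarrow> nat) \<Rightarrow> (nat \<Rightarrow> nat) \<Rightarrow> bool" where
  "block_step k n x y \<longleftrightarrow>
     x \<in> Sym n \<and> (\<exists>a b. same_block k n a b \<and> x a < x b \<and> y = x \<circ> transpose a b)"

lemma block_stepI:
  "x \<in> Sym n \<Longrightarrow> same_block k n a b \<Longrightarrow> x a < x b \<Longrightarrow> block_step k n x (x \<circ> transpose a b)"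
  by (auto simp: block_step_def)

lemma block_step_len: "block_step k n x y \<Longrightarrow> len n x < len n y"
  by (auto simp: block_step_def same_block_def intro!: len_less_transpose)

lemma block_step_Sym: "block_step k n x y \<Longrightarrow> x \<in> Sym n \<and> y \<in> Sym n"
  by (auto simp: block_step_def same_block_def intro!: Sym_transpose)

lemma block_steps_len: "(block_step k n)\<^sup>*\<^sup>* x y \<Longrightarrow> x = y \<or> len n x < len n y"
  by (induction rule: rtranclp_induct) (auto dest: block_step_len)

lemma block_covers_steps: "(block_cover k n)\<^sup>*\<^sup>* x y \<Longrightarrow> (block_step k n)\<^sup>*\<^sup>* x y"
proof (induction rule: rtranclp_induct)
  case (step v w)
  have "block_step k n v w" using step.hyps(2) by (auto elim!: block_coverE simp: block_step_def)
  with step.IH show ?case by simp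
qed simp

text \<open>
  A simple transposition keeps the order of every pair of positions except the pair it moves.
\<close>

lemma block_step_conj_simple:
  assumes "block_step k n x y" and i: "same_block k n i (Suc i)"
  defines "s \<equiv> transpose i (Suc i)"
  shows "y = x \<circ> s \<or> block_step k n (x \<circ> s) (y \<circ> s)"
proof (cases "y = x \<circ> s")
  case False
  obtain a b where ab: "x \<in> Sym n" "same_block k n a b" "x a < x b" "y = x \<circ> transpose a b"
    using assms(1) by (auto simp: block_step_def)
  have "\<not> (a = i \<and> b = Suc i)" using False ab(4) by (auto simp: s_def)
  then have sb: "same_block k n (s a) (s b)"
    using ab(2) i by (auto simp: same_block_def s_def transpose_def)
  have "y \<circ> s = x \<circ> s \<circ> transpose (s a) (s b)"
    using conj_transpose[of x i "Suc i" "s a" "s b"] by (simp add: s_def ab(4))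
  moreover have "x \<circ> s \<in> Sym n"
    using ab(1) i unfolding s_def by (intro Sym_transpose) (auto simp: same_block_def)
  ultimately show ?thesis
    using block_stepI[OF _ sb, of "x \<circ> s"] ab(3) by (simp add: s_def)
qed simp

lemma simple_down_block_step:
  assumes "x \<in> Sym n" "same_block k n i (Suc i)" "x (Suc i) < x i"
  shows "block_step k n (x \<circ> transpose i (Suc i)) x"
proof -
  have "x \<circ> transpose i (Suc i) \<in> Sym n"
    using assms by (intro Sym_transpose) (auto simp: same_block_def)
  from block_stepI[OF this assms(2)] assms(3) show ?thesis by simp
qed

text \<open>
  This and the next lemma are the lifting properties of \<open>x \<le> w\<close> for a simple transposition \<open>s\<close>:
  \<open>xs \<le> w\<close> if \<open>ws < w\<close>, and \<open>xs \<le> ws\<close> if \<open>xs < x\<close>. In a chain of steps translated by \<open>s\<close>, only a step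
  that is \<open>s\<close> itself fails to be a step, and it can be left out.
\<close>

lemma lift_simple_below:
  assumes "(block_step k n)\<^sup>*\<^sup>* x w" "w \<in> Sym n"
    and i: "same_block k n i (Suc i)" and "w (Suc i) < w i"
  shows "(block_step k n)\<^sup>*\<^sup>* (x \<circ> transpose i (Suc i)) w"
  using assms(1)
proof (induction rule: converse_rtranclp_induct)
  case base
  show ?case using simple_down_block_step[OF assms(2) i assms(4)] by blast
next
  case (step x x')
  from block_step_conj_simple[OF step.hyps(1) i] step show ?case
    by (metis converse_rtranclp_into_rtranclp)
qed

lemma lift_simple_both:
  assumes "(block_step k n)\<^sup>*\<^sup>* x w" "x \<in> Sym n"
    and i: "same_block k n i (Suc i)" and "x (Suc i) < x i"
  shows "(block_step k n)\<^sup>*\<^sup>* (x \<circ> transpose i (Suc i)) (w \<circ> transpose i (Suc i))"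
  using assms(1)
proof (induction rule: rtranclp_induct)
  case (step v w)
  from block_step_conj_simple[OF step.hyps(2) i] show ?case
  proof
    assume w: "w = v \<circ> transpose i (Suc i)"
    show ?thesis
      unfolding w transpose_transpose_comp
      by (rule converse_rtranclp_into_rtranclp[OF simple_down_block_step[OF assms(2) i assms(4)]
        step.hyps(1)])
  qed (rule rtranclp.rtrancl_into_rtrancl[OF step.IH])
qed simp

lemma descent_between:
  fixes v :: "nat \<Rightarrow> nat"
  assumes "a < b" "v b < v a"
  obtains i where "a \<le> i" "Suc i \<le> b" "v (Suc i) < v i"
proof -
  have "\<exists>i\<ge>a. Suc i \<le> b \<and> v (Suc i) < v i"
  proof (rule ccontr)
    assume "\<not> ?thesis"
    then have m: "v i \<le> v (Suc i)" if "a \<le> i" "Suc i \<le> b" for i using that by (meson not_le)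
    have "v a \<le> v j" if "a \<le> j" "j \<le> b" for j
      using that by (induction j rule: dec_induct) (auto intro: m order_trans)
    then show False using assms by (metis less_imp_le_nat not_le order_refl)
  qed
  then show ?thesis using that by blast
qed

lemma block_steps_descent:
  assumes "(block_step k n)\<^sup>*\<^sup>* x w" "x \<noteq> w"
  obtains i where "same_block k n i (Suc i)" "w (Suc i) < w i"
proof -
  from assms obtain v where "block_step k n v w" by (auto elim: rtranclp.cases)
  then obtain a b where ab: "same_block k n a b" "w b < w a" by (auto simp: block_step_def)
  then obtain i where i: "a \<le> i" "Suc i \<le> b" "w (Suc i) < w i"
    using descent_between[of a b w] by (auto simp: same_block_def)
  with ab(1) have "same_block k n i (Suc i)" by (auto simp: same_block_def)
  with i(3) show ?thesis using that by blast
qed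

text \<open>
  A \<open>k\<close>-Bruhat chain from \<open>u\<close> to \<open>x\<close> that still has to climb from \<open>x\<close> to \<open>w\<close> inside a coset can
  be brought, after translation by some \<open>z\<close>, to the situation in which only one simple block cover
  from \<open>y\<close> to \<open>wz\<close> is missing. Let \<open>s\<close> be a simple transposition of a block with \<open>ws < w\<close>. Because
  descents inside a block are inherited downwards along \<open>k\<close>-Bruhat chains, \<open>us < u\<close> as well.
  If \<open>xs < x\<close>, all three elements are translated by \<open>s\<close>. If \<open>x < xs \<noteq> w\<close>, then \<open>xs \<le> w\<close> by
  lifting, and the step from \<open>x\<close> to \<open>xs\<close> is absorbed into the chain. The quantity
  \<open>2 len w - len x\<close> drops by one in both cases. Stopping at the last simple cover, instead of
  absorbing it too, is what produces exterior ridges below.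
\<close>

lemma block_gap_reduction:
  assumes "u \<in> Sym n" "k_chain k n u H w" "k_chain k n u F x"
    "(block_step k n)\<^sup>*\<^sup>* x w" "x \<noteq> w"
  shows "\<exists>z \<in> parabolic k n. \<exists>y F' i. F \<subseteq> F' \<and> same_block k n i (Suc i) \<and>
    k_chain k n (u \<circ> z) F' y \<and> y i < y (Suc i) \<and> w \<circ> z = y \<circ> transpose i (Suc i) \<and>
    k_chain k n (u \<circ> z) H (w \<circ> z) \<and> len n (w \<circ> z) + len n u = len n (u \<circ> z) + len n w"
  using assms
proof (induction "2 * len n w - len n x" arbitrary: u w H F x rule: less_induct)
  case less
  note u = less.prems(1) and H = less.prems(2) and F = less.prems(3) and xw = less.prems(4)
  have x: "x \<in> Sym n" and w: "w \<in> Sym n" using k_chain_Sym F H u by blast+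
  have lxw: "len n x < len n w" using block_steps_len[OF xw] less.prems(5) by auto
  obtain i where i: "same_block k n i (Suc i)" "w (Suc i) < w i"
    using block_steps_descent[OF xw less.prems(5)] .
  define s where "s = transpose i (Suc i)"
  have s: "s \<in> parabolic k n" unfolding s_def by (rule transpose_parabolic[OF i(1)])
  have "u i \<noteq> u (Suc i)" using Sym_inj[OF u] by (simp add: inj_eq)
  then have ui: "u (Suc i) < u i" using k_chain_block_ascent[OF H i(1)] i(2) by fastforce
  have "x i \<noteq> x (Suc i)" using Sym_inj[OF x] by (simp add: inj_eq)
  then consider "x i < x (Suc i)" "w = x \<circ> s" | "x i < x (Suc i)" "w \<noteq> x \<circ> s"
    | "x (Suc i) < x i" by linarith
  then show ?case
  proof cases
    case 1
    have "F \<subseteq> F \<and> same_block k n i (Suc i) \<and> k_chain k n (u \<circ> id) F x \<and> x i < x (Suc i) \<and>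
      w \<circ> id = x \<circ> transpose i (Suc i) \<and> k_chain k n (u \<circ> id) H (w \<circ> id) \<and>
      len n (w \<circ> id) + len n u = len n (u \<circ> id) + len n w"
      using 1 F H i(1) unfolding s_def comp_id by simp
    then show ?thesis using id_parabolic[of k n] by blast
  next
    case 2
    obtain F' where F': "F \<subseteq> F'" "k_chain k n u F' (x \<circ> s)"
      unfolding s_def using k_chain_then_simple[OF F u i(1) ui 2(1)] by blast
    have up: "(block_step k n)\<^sup>*\<^sup>* (x \<circ> s) w"
      unfolding s_def by (rule lift_simple_below[OF xw w i])
    have "len n (x \<circ> s) = Suc (len n x)" unfolding s_def by (rule len_simple_up[OF x i(1) 2(1)])
    then have "2 * len n w - len n (x \<circ> s) < 2 * len n w - len n x" using lxw by linarith
    from less.hyps[OF this u H F'(2) up 2(2)[symmetric]] F'(1) show ?thesis by (meson order_trans)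
  next
    case 3
    have l: "Suc (len n (x \<circ> s)) = len n x" "Suc (len n (u \<circ> s)) = len n u"
      "Suc (len n (w \<circ> s)) = len n w"
      unfolding s_def using len_simple_down[OF _ i(1)] x u w 3 ui i(2) by blast+
    have us: "u \<circ> s \<in> Sym n" by (rule Sym_comp[OF u parabolic_Sym[OF s]])
    have Hs: "k_chain k n (u \<circ> s) H (w \<circ> s)" by (rule k_chain_twist[OF H s]) (use l in linarith)
    have Fs: "k_chain k n (u \<circ> s) F (x \<circ> s)" by (rule k_chain_twist[OF F s]) (use l in linarith)
    have up: "(block_step k n)\<^sup>*\<^sup>* (x \<circ> s) (w \<circ> s)"
      unfolding s_def by (rule lift_simple_both[OF xw x i(1) 3])
    have ne: "x \<circ> s \<noteq> w \<circ> s" using l lxw by auto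
    have "2 * len n (w \<circ> s) - len n (x \<circ> s) < 2 * len n w - len n x" using l lxw by linarith
    from less.hyps[OF this us Hs Fs up ne]
    obtain z y F' j where z: "z \<in> parabolic k n" and P: "F \<subseteq> F'" "same_block k n j (Suc j)"
      "k_chain k n (u \<circ> s \<circ> z) F' y" "y j < y (Suc j)" "w \<circ> s \<circ> z = y \<circ> transpose j (Suc j)"
      "k_chain k n (u \<circ> s \<circ> z) H (w \<circ> s \<circ> z)"
      "len n (w \<circ> s \<circ> z) + len n (u \<circ> s) = len n (u \<circ> s \<circ> z) + len n (w \<circ> s)"
      by blast
    have "s \<circ> z \<in> parabolic k n" by (rule parabolic_comp[OF s z])
    moreover have "len n (w \<circ> s \<circ> z) + len n u = len n (u \<circ> s \<circ> z) + len n w"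
      using P(7) l by linarith
    ultimately show ?thesis using P(1-6) unfolding comp_assoc by blast
  qed
qed

text \<open>
  The last missing simple cover is absorbed like the others, and the translation is undone.
\<close>

lemma k_then_blocks_in_k_chain:
  assumes u: "u \<in> Sym n" and H: "k_chain k n u H w" and F: "k_chain k n u F x"
    and xw: "(block_step k n)\<^sup>*\<^sup>* x w"
  shows "\<exists>G. F \<subseteq> G \<and> k_chain k n u G w"
proof (cases "x = w")
  case True
  then show ?thesis using F by blast
next
  case False
  from block_gap_reduction[OF u H F xw False]
  obtain z y G i where z: "z \<in> parabolic k n" and P: "F \<subseteq> G" "same_block k n i (Suc i)"
    "k_chain k n (u \<circ> z) G y" "y i < y (Suc i)" "w \<circ> z = y \<circ> transpose i (Suc i)"
    "k_chain k n (u \<circ> z) H (w \<circ> z)"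
    "len n (w \<circ> z) + len n u = len n (u \<circ> z) + len n w"
    by blast
  have uz: "u \<circ> z \<in> Sym n" by (rule Sym_comp[OF u parabolic_Sym[OF z]])
  have "(w \<circ> z) (Suc i) < (w \<circ> z) i" unfolding P(5) using P(4) by simp
  moreover have "(u \<circ> z) i \<noteq> (u \<circ> z) (Suc i)" using Sym_inj[OF uz] by (metis inj_eq n_not_Suc_n)
  ultimately have d: "(u \<circ> z) (Suc i) < (u \<circ> z) i"
    using k_chain_block_ascent[OF P(6,2)] by (meson nat_neq_iff less_asym)
  obtain G' where "G \<subseteq> G'" "k_chain k n (u \<circ> z) G' (w \<circ> z)"
    unfolding P(5) using k_chain_then_simple[OF P(3) uz P(2) d P(4)] by blast
  then have "k_chain k n u G' w" using k_chain_twist_iff[OF z P(7)] by blast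
  then show ?thesis using P(1) \<open>G \<subseteq> G'\<close> by blast
qed

lemma bruhat_chain_in_k_chain:
  assumes "u \<in> Sym n" "k_chain k n u H w" "chain_image k (bruhat_cover n) u F w"
  shows "\<exists>G. F \<subseteq> G \<and> k_chain k n u G w"
  using bruhat_chain_k_then_block[OF assms(3)] k_then_blocks_in_k_chain[OF assms(1,2)]
    block_covers_steps[of k n] by (meson order_trans)

section \<open>A top face determines its chain\<close>

text \<open>
  Indexed chains, for the arguments that compare two chains position by position.
\<close>

definition k_path :: "nat \<Rightarrow> nat \<Rightarrow> (nat \<Rightarrow> nat \<Rightarrow> nat) \<Rightarrow> nat \<Rightarrow> bool" where
  "k_path k n f r \<longleftrightarrow> (\<forall>i<r. k_bruhat_cover k n (f i) (f (Suc i)))"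

lemma k_chain_path:
  assumes "k_chain k n u F w"
  shows "\<exists>f r. f 0 = u \<and> f r = w \<and> k_path k n f r \<and> F = (\<lambda>i. sigma k (f i)) ` {..r} \<and>
    len n w = len n u + r"
  using assms
proof (induction rule: chain_image.induct)
  case start
  show ?case by (rule exI[of _ "\<lambda>_. u"], rule exI[of _ 0]) (simp add: k_path_def)
next
  case (step F v w)
  then obtain f r where f: "f 0 = u" "f r = v" "k_path k n f r" "F = (\<lambda>i. sigma k (f i)) ` {..r}"
    "len n v = len n u + r" by blast
  let ?g = "f(Suc r := w)"
  have "k_path k n ?g (Suc r)"
    using f(2,3) step.hyps(2) by (auto simp: k_path_def less_Suc_eq)
  moreover have "insert (sigma k w) F = (\<lambda>i. sigma k (?g i)) ` {..Suc r}"
    using f(4) by (auto simp: atMost_Suc image_iff le_Suc_eq)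
  moreover have "len n w = len n u + Suc r" using f(5) k_cover_len[OF step.hyps(2)] by simp
  moreover have "?g 0 = u" "?g (Suc r) = w" using f(1) by simp_all
  ultimately show ?case by (intro exI conjI)
qed

text \<open>
  A \<open>k\<close>-Bruhat cover replaces one element of the image by a larger one. The sum of the image is
  therefore a rank function that orders every face and recovers the order of the chain from the
  set of its images.
\<close>

lemma k_cover_sum_less:
  assumes "k_bruhat_cover k n x y"
  shows "\<Sum>(sigma k x) < \<Sum>(sigma k y)"
proof -
  obtain a b where ab: "x a < x b" "sigma k y = insert (x b) (sigma k x - {x a})"
    "x a \<in> sigma k x" "x b \<notin> sigma k x"
    using assms by (rule k_bruhat_coverE) blast
  have fin: "finite (sigma k x)" by (simp add: sigma_def)
  have "\<Sum>(sigma k y) = x b + \<Sum>(sigma k x - {x a})" using ab fin by simp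
  moreover have "\<Sum>(sigma k x) = x a + \<Sum>(sigma k x - {x a})"
    using ab fin by (simp add: sum.remove)
  ultimately show ?thesis using ab(1) by simp
qed

lemma k_path_sum_less:
  assumes "k_path k n f r" "j \<le> r" "i < j"
  shows "\<Sum>(sigma k (f i)) < \<Sum>(sigma k (f j))"
  using assms(3,2)
proof (induction rule: less_Suc_induct)
  case (1 i)
  then have "k_bruhat_cover k n (f i) (f (Suc i))" using assms(1) by (simp add: k_path_def)
  then show ?case by (rule k_cover_sum_less)
qed auto

lemma k_path_sigma_inj:
  assumes "k_path k n f r" "i \<le> r" "j \<le> r" "sigma k (f i) = sigma k (f j)"
  shows "i = j"
  using k_path_sum_less[OF assms(1,3), of i] k_path_sum_less[OF assms(1,2), of j] assms(4)
  by (metis less_irrefl nat_neq_iff)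

lemma strict_enumeration_unique:
  fixes s t :: "nat \<Rightarrow> 'a" and wt :: "'a \<Rightarrow> nat"
  assumes s: "\<And>i j. i < j \<Longrightarrow> j < m \<Longrightarrow> wt (s i) < wt (s j)"
    and t: "\<And>i j. i < j \<Longrightarrow> j < m \<Longrightarrow> wt (t i) < wt (t j)"
    and eq: "s ` {..<m} = t ` {..<m}" and "i < m"
  shows "s i = t i"
  using \<open>i < m\<close>
proof (induction i rule: less_induct)
  case (less i)
  have "s i \<in> t ` {..<m}" "t i \<in> s ` {..<m}" using less.prems eq by auto
  then obtain j j' where j: "j < m" "s i = t j" and j': "j' < m" "t i = s j'" by auto
  have "i \<le> j" using less.IH[of j] less.prems s[of j i] j by (metis less_irrefl not_le)
  moreover have "i \<le> j'" using less.IH[of j'] less.prems t[of j' i] j' by (metis less_irrefl not_le)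
  ultimately have "wt (t i) \<le> wt (t j)" "wt (s i) \<le> wt (s j')"
    using t[of i j] s[of i j'] j(1) j'(1) by (metis le_less)+
  with j j' have "wt (t i) = wt (t j)" by simp
  then have "i = j" using t[of i j] j(1) \<open>i \<le> j\<close> by (metis le_less less_irrefl)
  then show ?case using j by simp
qed

text \<open>
  The increasing enumeration of \<open>{0, 1, 2, \<dots>}\<close> without \<open>j\<close>.
\<close>

definition skip :: "nat \<Rightarrow> nat \<Rightarrow> nat" where
  "skip j i = (if i < j then i else Suc i)"

lemma skip_image: "j \<le> r \<Longrightarrow> skip j ` {..<r} = {..r} - {j}"
proof (intro equalityI subsetI)
  fix x assume "j \<le> r" "x \<in> {..r} - {j}"
  then have "x = skip j (if x < j then x else x - 1)" "(if x < j then x else x - 1) < r"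
    by (auto simp: skip_def)
  then show "x \<in> skip j ` {..<r}" by blast
qed (auto simp: skip_def split: if_splits)

lemma k_cover_diffE:
  assumes "k_bruhat_cover k n x y"
  obtains a b where "inj x" "inj y" "a \<le> k" "k < b" "y = x \<circ> transpose a b" "x a < x b"
    "sigma k y = insert (x b) (sigma k x - {x a})"
    "sigma k x - sigma k y = {x a}" "sigma k y - sigma k x = {x b}"
    "\<forall>c. a < c \<and> c < b \<longrightarrow> \<not> (x a < x c \<and> x c < x b)"
proof (rule k_bruhat_coverE[OF assms])
  fix a b
  assume "x \<in> Sym n" "y \<in> Sym n" "a \<le> k" "k < b" "y = x \<circ> transpose a b" "x a < x b"
    and *: "sigma k y = insert (x b) (sigma k x - {x a})" "x a \<in> sigma k x" "x b \<notin> sigma k x"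
    and "\<And>c. a < c \<Longrightarrow> c < b \<Longrightarrow> \<not> (x a < x c \<and> x c < x b)"
  moreover have "sigma k x - sigma k y = {x a}" "sigma k y - sigma k x = {x b}"
    using * by auto
  ultimately show thesis by (intro that[of a b]) (simp_all add: Sym_inj)
qed

text \<open>
  The two images determine which two values are exchanged, hence each end of the cover determines
  the other.
\<close>

lemma k_cover_sigma_up:
  assumes "k_bruhat_cover k n x y" "k_bruhat_cover k n x y'" "sigma k y = sigma k y'"
  shows "y = y'"
proof -
  obtain a b where ab: "inj x" "y = x \<circ> transpose a b"
    "sigma k x - sigma k y = {x a}" "sigma k y - sigma k x = {x b}"
    using assms(1) by (rule k_cover_diffE)
  obtain c d where cd: "y' = x \<circ> transpose c d"
    "sigma k x - sigma k y' = {x c}" "sigma k y' - sigma k x = {x d}"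
    using assms(2) by (rule k_cover_diffE)
  have "x a = x c" "x b = x d" using ab(3,4) cd(2,3) assms(3) by simp_all
  then show ?thesis using ab(1,2) cd(1) by (simp add: inj_eq)
qed

lemma k_cover_sigma_down:
  assumes "k_bruhat_cover k n x y" "k_bruhat_cover k n x' y" "sigma k x = sigma k x'"
  shows "x = x'"
proof -
  obtain a b where ab: "inj y" "y = x \<circ> transpose a b"
    "sigma k x - sigma k y = {x a}" "sigma k y - sigma k x = {x b}"
    using assms(1) by (rule k_cover_diffE)
  obtain c d where cd: "y = x' \<circ> transpose c d"
    "sigma k x' - sigma k y = {x' c}" "sigma k y - sigma k x' = {x' d}"
    using assms(2) by (rule k_cover_diffE)
  have "x a = x' c" "x b = x' d" using ab(3,4) cd(2,3) assms(3) by simp_all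
  moreover have "y b = x a" "y a = x b" by (simp_all add: ab(2))
  moreover have "y d = x' c" "y c = x' d" by (simp_all add: cd(1))
  ultimately have "y b = y d" "y a = y c" by simp_all
  then have e: "c = a" "d = b" using ab(1) by (simp_all add: inj_eq)
  have "x = y \<circ> transpose a b" by (simp only: ab(2) transpose_transpose_comp)
  moreover have "x' = y \<circ> transpose a b" by (simp only: cd(1) e transpose_transpose_comp)
  ultimately show ?thesis by simp
qed

lemma k_path_agree_low:
  assumes "k_path k n f r" "k_path k n g r'" "f 0 = g 0" "m \<le> r" "m \<le> r'"
    and "\<And>i. i \<le> m \<Longrightarrow> sigma k (f i) = sigma k (g i)" and "i \<le> m"
  shows "f i = g i"
  using \<open>i \<le> m\<close>
proof (induction i)
  case (Suc i)
  then have e: "f i = g i" and i: "i < r" "i < r'" using assms(4,5) by auto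
  have "k_bruhat_cover k n (f i) (f (Suc i))" "k_bruhat_cover k n (g i) (g (Suc i))"
    using assms(1,2) i by (simp_all add: k_path_def)
  then show ?case unfolding e using assms(6)[OF Suc.prems] by (rule k_cover_sigma_up)
qed (use assms in simp)

lemma k_path_agree_high:
  assumes "k_path k n f r" "k_path k n g r" "f r = g r"
    and "\<And>i. m \<le> i \<Longrightarrow> i \<le> r \<Longrightarrow> sigma k (f i) = sigma k (g i)" and "m \<le> i" "i \<le> r"
  shows "f i = g i"
  using \<open>i \<le> r\<close> \<open>m \<le> i\<close>
proof (induction i rule: inc_induct)
  case (step i)
  then have e: "f (Suc i) = g (Suc i)" and s: "sigma k (f i) = sigma k (g i)" and i: "i < r"
    using assms(4)[of i] by auto
  have "k_bruhat_cover k n (f i) (f (Suc i))" "k_bruhat_cover k n (g i) (g (Suc i))"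
    using assms(1,2) i by (simp_all add: k_path_def)
  then show ?case unfolding e using s by (rule k_cover_sigma_down)
qed (use assms in simp)

section \<open>At most two top faces contain a ridge\<close>

text \<open>
  Two consecutive exchanges between \<open>p\<close> and \<open>q\<close>, described by \<open>A\<close>, \<open>B\<close> and the permutation of
  values \<open>\<zeta>\<close>. If they share a value, then \<open>B\<close> arises from \<open>A\<close> by the single exchange of some \<open>a\<close>
  for some \<open>b\<close>, and \<open>\<zeta>\<close> is a 3-cycle on \<open>a\<close>, \<open>b\<close> and the shared value, which tells the shared
  value and the order of the exchanges. If they do not, then \<open>\<zeta>\<close> consists of the two disjoint
  exchanges, and the middle image is given by the one that is performed first.
\<close>

lemma two_step_middle:
  assumes px: "k_bruhat_cover k n p x" and xq: "k_bruhat_cover k n x q"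
  defines "A \<equiv> sigma k p" and "B \<equiv> sigma k q" and "\<zeta> \<equiv> \<lambda>v. q (inv p v)"
  shows "(\<exists>a b. A - B = {a} \<and> B - A = {b} \<and>
      sigma k x = (if \<zeta> a = b then insert (\<zeta> b) (A - {a}) else insert b (A - {\<zeta> a})))
    \<or> (\<exists>a c. a \<noteq> c \<and> A - B = {a, c} \<and> sigma k x = insert (\<zeta> a) (A - {a}))"
proof -
  obtain a b where ab: "p \<in> Sym n" "a \<le> k" "k < b" "x = p \<circ> transpose a b" "p a < p b"
    "sigma k x = insert (p b) (A - {p a})" "p a \<in> A" "p b \<notin> A"
    using px unfolding A_def by (rule k_bruhat_coverE) blast
  obtain c d where cd: "c \<le> k" "k < d" "q = x \<circ> transpose c d" "x c < x d"
    "B = insert (x d) (sigma k x - {x c})" "x c \<in> sigma k x" "x d \<notin> sigma k x"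
    using xq unfolding B_def by (rule k_bruhat_coverE) blast
  have i: "p i = p j \<longleftrightarrow> i = j" for i j using Sym_inj[OF ab(1)] by (simp add: inj_eq)
  have z: "\<zeta> (p i) = q i" for i using Sym_inj[OF ab(1)] by (simp add: \<zeta>_def)
  have ne: "a \<noteq> b" "c \<noteq> d" "a \<noteq> d" "c \<noteq> b" using ab(2,3) cd(1,2) by auto
  consider "c = a" "d = b" | "c = a" "d \<noteq> b" | "c \<noteq> a" "d = b" | "c \<noteq> a" "d \<noteq> b" by blast
  then show ?thesis
  proof cases
    case 1
    then show ?thesis using ab cd by simp
  next
    case 2
    then have v: "x c = p b" "x d = p d" "q a = p d" "q d = p b"
      using ne by (simp_all add: ab(4) cd(3))
    have "B = insert (p d) (A - {p a})" "p d \<notin> A"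
      using cd(5,7) ab(6,8) unfolding v using 2 i ne by auto
    then have "A - B = {p a}" "B - A = {p d}" using ab(7) i ne by auto
    moreover have "\<zeta> (p a) = p d" "\<zeta> (p d) = p b" unfolding z using v by simp_all
    ultimately show ?thesis using ab(6) by simp
  next
    case 3
    then have v: "x c = p c" "x d = p a" "q c = p a"
      using ne by (simp_all add: ab(4) cd(3))
    have c: "p c \<in> A" "p c \<noteq> p a" using cd(6) ab(6) i 3 ne by (auto simp: v)
    have "B = insert (p b) (A - {p c})"
      using cd(5) ab(6-8) c unfolding v using i ne by auto
    then have "A - B = {p c}" "B - A = {p b}" using ab(7,8) c by auto
    moreover have "\<zeta> (p c) = p a" unfolding z using v by simp
    ultimately show ?thesis using ab(6) i ne by simp
  next
    case 4
    then have v: "x c = p c" "x d = p d" "q a = p b"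
      using ne by (simp_all add: ab(4) cd(3))
    have c: "p c \<in> A" "p c \<noteq> p a" "p d \<notin> A" using cd(6,7) ab(6) i 4 ne by (auto simp: v)
    have "A - B = {p a, p c}" using cd(5) ab(6-8) c i 4 ne unfolding v by auto
    moreover have "\<zeta> (p a) = p b" unfolding z using v by simp
    ultimately show ?thesis using ab(6) c(2) by (metis (no_types))
  qed
qed

lemma middle_unique:
  assumes "k_bruhat_cover k n p x" "k_bruhat_cover k n x q"
    "k_bruhat_cover k n p x'" "k_bruhat_cover k n x' q" "sigma k p - sigma k q = {a}"
  shows "sigma k x = sigma k x'"
proof -
  have n: "{a} \<noteq> {b, c}" if "b \<noteq> c" for b c using that by auto
  show ?thesis
    using two_step_middle[OF assms(1,2)] two_step_middle[OF assms(3,4)] n unfolding assms(5)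
    by (elim disjE exE conjE) auto
qed

lemma middle_at_most_two:
  assumes "k_bruhat_cover k n p x1" "k_bruhat_cover k n x1 q"
    "k_bruhat_cover k n p x2" "k_bruhat_cover k n x2 q"
    "k_bruhat_cover k n p x3" "k_bruhat_cover k n x3 q"
  shows "sigma k x1 = sigma k x2 \<or> sigma k x1 = sigma k x3 \<or> sigma k x2 = sigma k x3"
proof (cases "\<exists>a. sigma k p - sigma k q = {a}")
  case True
  then show ?thesis using middle_unique[OF assms(1-4)] by blast
next
  case False
  have "\<exists>a c. a \<noteq> c \<and> sigma k p - sigma k q = {a, c} \<and>
      sigma k x = insert (q (inv p a)) (sigma k p - {a})"
    if "k_bruhat_cover k n p x" "k_bruhat_cover k n x q" for x
    using two_step_middle[OF that] False by blast
  from this[OF assms(1,2)] this[OF assms(3,4)] this[OF assms(5,6)]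
  show ?thesis by (auto simp: doubleton_eq_iff)
qed

text \<open>
  If \<open>p\<close> and \<open>q\<close> are joined by two exchanges whose total effect on the image is a single exchange
  of \<open>a\<close> for \<open>b\<close>, then the exchanges share a value \<open>c\<close> with \<open>a < c < b\<close>, placed in the same block as
  \<open>a\<close> or as \<open>b\<close>. A direct exchange of \<open>a\<close> for \<open>b\<close> is a cover only if \<open>c\<close> is not placed between them,
  which fixes the order of the two positions in the common block. But the values at these two
  positions in \<open>q'\<close> are interchanged in comparison with \<open>p\<close>, so the orders required by the two direct
  exchanges are opposite. In the proof \<open>a\<close>, \<open>b\<close>, \<open>c\<close>, \<open>d\<close> denote positions.
\<close>

lemma middle_between_singles_impossible:
  assumes px: "k_bruhat_cover k n p x" and xq: "k_bruhat_cover k n x q"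
    and pp: "k_bruhat_cover k n p p'" and qq: "k_bruhat_cover k n q' q"
    and s: "sigma k p' = sigma k q" "sigma k q' = sigma k p"
  shows False
proof -
  obtain a b where ab: "p \<in> Sym n" "a \<le> k" "k < b" "x = p \<circ> transpose a b" "p a < p b"
    "sigma k x = insert (p b) (sigma k p - {p a})" "p a \<in> sigma k p" "p b \<notin> sigma k p"
    using px by (rule k_bruhat_coverE) blast
  obtain c d where cd: "q \<in> Sym n" "c \<le> k" "k < d" "q = x \<circ> transpose c d" "x c < x d"
    "sigma k q = insert (x d) (sigma k x - {x c})" "x c \<in> sigma k x" "x d \<notin> sigma k x"
    using xq by (rule k_bruhat_coverE) blast
  obtain e f where ef: "e \<le> k" "k < f"
    "sigma k p' = insert (p f) (sigma k p - {p e})" "p e \<in> sigma k p" "p f \<notin> sigma k p"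
    and gap_p: "\<And>i. e < i \<Longrightarrow> i < f \<Longrightarrow> \<not> (p e < p i \<and> p i < p f)"
    using pp by (rule k_bruhat_coverE) blast
  obtain g h where gh: "g \<le> k" "k < h" "q = q' \<circ> transpose g h"
    "sigma k q = insert (q' h) (sigma k q' - {q' g})" "q' g \<in> sigma k q'" "q' h \<notin> sigma k q'"
    and gap_q: "\<And>i. g < i \<Longrightarrow> i < h \<Longrightarrow> \<not> (q' g < q' i \<and> q' i < q' h)"
    using qq by (rule k_bruhat_coverE) blast
  have ip: "p i = p j \<longleftrightarrow> i = j" for i j using Sym_inj[OF ab(1)] by (simp add: inj_eq)
  have iq: "q i = q j \<longleftrightarrow> i = j" for i j using Sym_inj[OF cd(1)] by (simp add: inj_eq)
  have ne: "a \<noteq> b" "c \<noteq> d" "a \<noteq> d" "c \<noteq> b" using ab(2,3) cd(2,3) by auto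
  have down: "sigma k p - sigma k q = {p e}" "sigma k q - sigma k p = {p f}"
    using ef(3-5) s(1) by auto
  have "sigma k p - sigma k q = {q' g}" "sigma k q - sigma k p = {q' h}"
    using gh(4-6) s(2) by auto
  then have q'v: "q' g = p e" "q' h = p f" using down by auto
  have qv: "q h = p e" "q g = p f" and qo: "\<And>i. i \<noteq> g \<Longrightarrow> i \<noteq> h \<Longrightarrow> q' i = q i"
    using q'v by (simp_all add: gh(3))
  consider "c = a" "d = b" | "c = a" "d \<noteq> b" | "c \<noteq> a" "d = b" | "c \<noteq> a" "d \<noteq> b" by blast
  then show ?thesis
  proof cases
    case 1
    then show ?thesis using ab cd by simp
  next
    case 2
    then have v: "x c = p b" "x d = p d" "q a = p d" "q d = p b" "q b = p a"
      using ne by (simp_all add: ab(4) cd(4))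
    have "p a \<in> sigma k p - sigma k q" "p d \<in> sigma k q - sigma k p"
      using cd(5-8) ab(6-8) 2 ip ne unfolding v by auto
    then have e: "e = a" "f = d" using down ip by auto
    then have g: "g = a" "h = b" using qv v iq by metis+
    have "p a < p b" "p b < p d" using ab(5) cd(5) v by simp_all
    moreover have "q' a < q' d" "q' d < q' b"
      using calculation qo[of d] v q'v e g ne 2 by simp_all
    \<comment> \<open>The first cover requires \<open>d < b\<close>, the second \<open>b < d\<close>.\<close>
    moreover have "b < d \<or> d < b" using 2 by linarith
    ultimately show ?thesis
      using gap_p[of b] gap_q[of d] e g 2 ab(2,3) cd(3) by (elim disjE) simp_all
  next
    case 3
    then have v: "x c = p c" "x d = p a" "q c = p a" "q a = p b" "q d = p c"
      using ne by (simp_all add: ab(4) cd(4))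
    have "p c \<in> sigma k p - sigma k q" "p b \<in> sigma k q - sigma k p"
      using cd(5-8) ab(6-8) 3 ip ne unfolding v by auto
    then have e: "e = c" "f = b" using down ip by auto
    then have g: "g = a" "h = d" using qv v iq by metis+
    have "p c < p a" "p a < p b" using ab(5) cd(5) v by simp_all
    moreover have "q' a < q' c" "q' c < q' d"
      using calculation qo[of c] v q'v e g ne 3 by simp_all
    \<comment> \<open>The first cover requires \<open>a < c\<close>, the second \<open>c < a\<close>.\<close>
    moreover have "a < c \<or> c < a" using 3 by linarith
    ultimately show ?thesis
      using gap_p[of a] gap_q[of c] e g 3 ab(2,3) cd(2,3) by (elim disjE) simp_all
  next
    case 4
    then have v: "x c = p c" "x d = p d"
      using ne by (simp_all add: ab(4))
    have "p a \<in> sigma k p - sigma k q" "p c \<in> sigma k p - sigma k q"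
      using cd(5-8) ab(6-8) 4 ip ne unfolding v by auto
    then show ?thesis using down ip 4 by auto
  qed
qed

text \<open>
  The chain \<open>f\<close> of a top face from \<open>u\<close> to \<open>w\<close>, whose \<open>j\<close>-th image is the one that is missing in
  the ridge \<open>F\<close>.
\<close>

definition facet_path ::
    "nat \<Rightarrow> nat \<Rightarrow> (nat \<Rightarrow> nat) \<Rightarrow> (nat \<Rightarrow> nat) \<Rightarrow> nat set set \<Rightarrow> nat \<Rightarrow> (nat \<Rightarrow> nat \<Rightarrow> nat) \<Rightarrow> nat \<Rightarrow> bool"
  where
  "facet_path k n u w F r f j \<longleftrightarrow> k_path k n f r \<and> f 0 = u \<and> f r = w \<and> j \<le> r \<and>
     F = (\<lambda>i. sigma k (f i)) ` ({..r} - {j})"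

lemma k_path_card:
  assumes "k_path k n f r"
  shows "card ((\<lambda>i. sigma k (f i)) ` {..r}) = Suc r"
  using k_path_sigma_inj[OF assms] by (subst card_image) (auto simp: inj_on_def)

lemma k_chain_card: "k_chain k n u G w \<Longrightarrow> finite G \<and> card G = Suc (len n w - len n u)"
  using k_chain_path[of k n u G w] k_path_card by fastforce

lemma facet_path_exists:
  assumes "k_chain k n u G w" "F \<subseteq> G" "card F = len n w - len n u"
  obtains f j where "facet_path k n u w F (len n w - len n u) f j"
    "G = insert (sigma k (f j)) F"
proof -
  obtain f r where f: "f 0 = u" "f r = w" "k_path k n f r" "G = (\<lambda>i. sigma k (f i)) ` {..r}"
    "len n w = len n u + r"
    using k_chain_path[OF assms(1)] by blast
  have r: "r = len n w - len n u" using f(5) by simp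
  have fin: "finite G" "card G = Suc r" using k_chain_card[OF assms(1)] r by auto
  then have "finite F" using finite_subset[OF assms(2)] by blast
  then have "card (G - F) = 1" using fin assms(2,3) r by (simp add: card_Diff_subset)
  then obtain X where X: "G - F = {X}" by (auto simp: card_1_singleton_iff)
  then have "X \<in> G" by blast
  then obtain j where j: "j \<le> r" "X = sigma k (f j)" using f(4) by auto
  have "F = G - {X}" using X assms(2) by blast
  also have "\<dots> = (\<lambda>i. sigma k (f i)) ` ({..r} - {j})"
    using k_path_sigma_inj[OF f(3)] j unfolding f(4) by auto
  finally have "facet_path k n u w F r f j" using f j by (simp add: facet_path_def)
  moreover have "G = insert (sigma k (f j)) F" using X assms(2) j(2) by blast
  ultimately show ?thesis using that r by blast
qed

lemma facet_path_skip:
  assumes "facet_path k n u w F r f j"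
  shows "F = (\<lambda>i. sigma k (f (skip j i))) ` {..<r}"
    "a < b \<Longrightarrow> b < r \<Longrightarrow> \<Sum>(sigma k (f (skip j a))) < \<Sum>(sigma k (f (skip j b)))"
proof -
  have "F = (\<lambda>i. sigma k (f i)) ` skip j ` {..<r}"
    using assms skip_image[of j r] by (simp add: facet_path_def)
  then show "F = (\<lambda>i. sigma k (f (skip j i))) ` {..<r}" by (simp only: image_image)
  assume "a < b" "b < r"
  then show "\<Sum>(sigma k (f (skip j a))) < \<Sum>(sigma k (f (skip j b)))"
    using assms by (intro k_path_sum_less[of k n f r]) (auto simp: facet_path_def skip_def)
qed

text \<open>
  Both sides enumerate the ridge in the order of increasing sums.
\<close>

lemma facet_paths_same_ridge:
  assumes "facet_path k n u w F r f j" "facet_path k n u w F r g j'" "i < r"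
  shows "sigma k (f (skip j i)) = sigma k (g (skip j' i))"
proof (rule strict_enumeration_unique[where wt = Sum and m = r and i = i
    and s = "\<lambda>i. sigma k (f (skip j i))" and t = "\<lambda>i. sigma k (g (skip j' i))"])
  show "(\<lambda>i. sigma k (f (skip j i))) ` {..<r} = (\<lambda>i. sigma k (g (skip j' i))) ` {..<r}"
    using facet_path_skip(1)[OF assms(1)] facet_path_skip(1)[OF assms(2)] by simp
qed (use assms facet_path_skip(2)[OF assms(1)] facet_path_skip(2)[OF assms(2)] in blast)+

text \<open>
  Two top faces over a common ridge have the same chain below the first and above the second gap.
  Between the gaps their images agree with a shift by one.
\<close>

lemma facet_paths_low:
  assumes f: "facet_path k n u w F r f j" and g: "facet_path k n u w F r g j'"
    and "j \<le> j'" "i < j"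
  shows "f i = g i"
proof (rule k_path_agree_low[where m = "j - 1"])
  show "k_path k n f r" "k_path k n g r" "f 0 = g 0"
    using f g by (simp_all add: facet_path_def)
  have "j \<le> r" using f by (simp add: facet_path_def)
  show "sigma k (f l) = sigma k (g l)" if l: "l \<le> j - 1" for l
  proof -
    have "l < j" "l < j'" "l < r" using l assms(3,4) \<open>j \<le> r\<close> by linarith+
    then show ?thesis using facet_paths_same_ridge[OF f g, of l] by (simp add: skip_def)
  qed
qed (use assms(4) f in \<open>auto simp: facet_path_def\<close>)

lemma facet_paths_high:
  assumes f: "facet_path k n u w F r f j" and g: "facet_path k n u w F r g j'"
    and "j \<le> j'" "j' < i" "i \<le> r"
  shows "f i = g i"
proof (rule k_path_agree_high[where m = "Suc j'" and r = r])
  show "k_path k n f r" "k_path k n g r" "f r = g r"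
    using f g by (simp_all add: facet_path_def)
  show "sigma k (f l) = sigma k (g l)" if l: "Suc j' \<le> l" "l \<le> r" for l
  proof -
    from l(1) obtain l' where l': "l = Suc l'" by (cases l) auto
    then have "\<not> l' < j" "\<not> l' < j'" "l' < r" using l assms(3) by linarith+
    then show ?thesis
      using facet_paths_same_ridge[OF f g, of l'] l' by (simp add: skip_def)
  qed
qed (use assms in auto)

lemma facet_paths_between:
  assumes f: "facet_path k n u w F r f j" and g: "facet_path k n u w F r g j'"
    and "j \<le> i" "i < j'"
  shows "sigma k (f (Suc i)) = sigma k (g i)"
  using facet_paths_same_ridge[OF f g, of i] assms(3,4) g
  by (simp add: skip_def facet_path_def)

lemma facet_path_cover:
  "facet_path k n u w F r f j \<Longrightarrow> i < r \<Longrightarrow> k_bruhat_cover k n (f i) (f (Suc i))"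
  by (simp add: facet_path_def k_path_def)

lemma facet_path_endpoint:
  assumes f: "facet_path k n u w F r f j"
  shows "sigma k u \<in> F \<longleftrightarrow> j \<noteq> 0" "sigma k w \<in> F \<longleftrightarrow> j \<noteq> r"
proof -
  have p: "k_path k n f r" and e: "f 0 = u" "f r = w" "j \<le> r"
    and F: "F = (\<lambda>i. sigma k (f i)) ` ({..r} - {j})"
    using f by (simp_all add: facet_path_def)
  have m: "sigma k (f i) \<in> F \<longleftrightarrow> i \<noteq> j" if "i \<le> r" for i
    using k_path_sigma_inj[OF p that] that unfolding F by auto
  show "sigma k u \<in> F \<longleftrightarrow> j \<noteq> 0" "sigma k w \<in> F \<longleftrightarrow> j \<noteq> r"
    using m[of 0] m[of r] e by auto
qed

lemma k_cover_single: "k_bruhat_cover k n x y \<Longrightarrow> \<exists>a. sigma k x - sigma k y = {a}"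
  by (elim k_cover_diffE) blast

text \<open>
  An earlier gap \<open>j\<close> supplies the cover into the upper end of the gap \<open>j'\<close>; the hypothesis supplies
  the cover out of its lower end, which a third chain without a gap up to \<open>j'\<close> would provide.
\<close>

lemma later_gap_not_single:
  assumes f: "facet_path k n u w F r f j" and g: "facet_path k n u w F r g j'"
    and "j < j'" "j' < r"
    and p': "k_bruhat_cover k n (g (j' - 1)) p'" "sigma k p' = sigma k (g (Suc j'))"
  shows False
proof (rule middle_between_singles_impossible)
  show "k_bruhat_cover k n (g (j' - 1)) (g j')"
    using facet_path_cover[OF g, of "j' - 1"] assms(3,4) by simp
  show "k_bruhat_cover k n (g j') (g (Suc j'))" using facet_path_cover[OF g] assms(4) by simp
  show "k_bruhat_cover k n (g (j' - 1)) p'" by (rule p'(1))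
  show "k_bruhat_cover k n (f j') (g (Suc j'))"
    using facet_path_cover[OF f assms(4)] facet_paths_high[OF f g, of "Suc j'"] assms(3,4) by simp
  show "sigma k (f j') = sigma k (g (j' - 1))"
    using facet_paths_between[OF f g, of "j' - 1"] assms(3) by simp
qed (use p' in auto)

text \<open>
  Gaps at three different places are impossible. If two of the gaps coincide and the third does not,
  then the third chain jumps over the common gap in one cover, so the gap admits only one middle
  image. A gap common to all three admits at most two.
\<close>

lemma three_facets_not_distinct:
  assumes f: "facet_path k n u w F r f j" and g: "facet_path k n u w F r g j'"
    and h: "facet_path k n u w F r h j''" and "j \<le> j'" "j' \<le> j''" "0 < j" "j'' < r"
  shows "sigma k (f j) = sigma k (g j') \<or> sigma k (f j) = sigma k (h j'') \<or>
    sigma k (g j') = sigma k (h j'')"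
proof -
  have c: "k_bruhat_cover k n (f' (i - 1)) (f' i)" "k_bruhat_cover k n (f' i) (f' (Suc i))"
    if "facet_path k n u w F r f' l" "0 < i" "i < r" for f' i l
    using facet_path_cover[OF that(1), of "i - 1"] facet_path_cover[OF that(1), of i] that by simp_all
  consider "j < j'" "j' < j''" | "j = j'" "j' < j''" | "j < j'" "j' = j''" | "j = j'" "j' = j''"
    using assms(4,5) by linarith
  then show ?thesis
  proof cases
    case 1
    have "k_bruhat_cover k n (g (j' - 1)) (h j')"
      using c(1)[OF h, of j'] facet_paths_low[OF g h, of "j' - 1"] 1 assms(7) by simp
    moreover have "sigma k (h j') = sigma k (g (Suc j'))"
      using facet_paths_between[OF g h, of j'] 1 by simp
    moreover have "j' < r" using 1 assms(7) by simp
    ultimately have False by (intro later_gap_not_single[OF f g 1(1)])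
    then show ?thesis ..
  next
    case 2
    have e: "f (j - 1) = g (j - 1)" "f (Suc j) = g (Suc j)"
      using facet_paths_low[OF f g, of "j - 1"] facet_paths_high[OF f g, of "Suc j"] 2 assms(6,7)
      by simp_all
    obtain a where "sigma k (h (j - 1)) - sigma k (h j) = {a}"
      using k_cover_single[OF c(1)[OF h assms(6)]] 2 assms(7) by auto
    then have "sigma k (f (j - 1)) - sigma k (f (Suc j)) = {a}"
      using facet_paths_between[OF f h, of j] facet_paths_low[OF f h, of "j - 1"] 2 assms(6) by simp
    from middle_unique[OF _ _ _ _ this, of n "f j" "g j"]
    show ?thesis using c[OF f assms(6)] c[OF g assms(6)] e 2 assms(7) by simp
  next
    case 3
    have e: "g (j' - 1) = h (j' - 1)" "g (Suc j') = h (Suc j')"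
      using facet_paths_low[OF g h, of "j' - 1"] facet_paths_high[OF g h, of "Suc j'"] 3 assms(6,7)
      by simp_all
    obtain a where "sigma k (f j') - sigma k (f (Suc j')) = {a}"
      using k_cover_single[OF c(2)[OF f, of j']] 3 assms(7) by auto
    then have "sigma k (g (j' - 1)) - sigma k (g (Suc j')) = {a}"
      using facet_paths_between[OF f g, of "j' - 1"] facet_paths_high[OF f g, of "Suc j'"] 3 assms(7)
      by simp
    from middle_unique[OF _ _ _ _ this, of n "g j'" "h j'"]
    show ?thesis using c[OF g, of j'] c[OF h, of j'] e 3 assms(7) by simp
  next
    case 4
    have e: "f (j - 1) = g (j - 1)" "f (Suc j) = g (Suc j)"
      "f (j - 1) = h (j - 1)" "f (Suc j) = h (Suc j)"
      using facet_paths_low[OF f g, of "j - 1"] facet_paths_high[OF f g, of "Suc j"]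
        facet_paths_low[OF f h, of "j - 1"] facet_paths_high[OF f h, of "Suc j"] 4 assms(6,7)
      by simp_all
    show ?thesis
      using middle_at_most_two[of k n "f (j - 1)" "f j" "f (Suc j)" "g j" "h j"]
        c[OF f assms(6)] c[OF g assms(6)] c[OF h assms(6)] e 4 assms(7) by simp
  qed
qed

definition facets_over :: "nat \<Rightarrow> nat \<Rightarrow> (nat \<Rightarrow> nat) \<Rightarrow> (nat \<Rightarrow> nat) \<Rightarrow> nat set set \<Rightarrow> nat set set set" where
  "facets_over k n u w F = {G. k_chain k n u G w \<and> F \<subseteq> G}"

text \<open>
  An end of the chain that is missing in \<open>F\<close> must be the one missing element.
\<close>

lemma facets_over_endpoint:
  assumes "card F = len n w - len n u" "G \<in> facets_over k n u w F"
  shows "sigma k u \<notin> F \<Longrightarrow> G = insert (sigma k u) F"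
    "sigma k w \<notin> F \<Longrightarrow> G = insert (sigma k w) F"
proof -
  have G: "k_chain k n u G w" "F \<subseteq> G" using assms(2) by (auto simp: facets_over_def)
  obtain f j where f: "facet_path k n u w F (len n w - len n u) f j" "G = insert (sigma k (f j)) F"
    using facet_path_exists[OF G assms(1)] .
  show "sigma k u \<notin> F \<Longrightarrow> G = insert (sigma k u) F" "sigma k w \<notin> F \<Longrightarrow> G = insert (sigma k w) F"
    using facet_path_endpoint[OF f(1)] f by (auto simp: facet_path_def)
qed

lemma facets_over_not_three:
  assumes F: "card F = len n w - len n u"
    and G: "G1 \<in> facets_over k n u w F" "G2 \<in> facets_over k n u w F" "G3 \<in> facets_over k n u w F"
  shows "G1 = G2 \<or> G1 = G3 \<or> G2 = G3"
proof (cases "sigma k u \<in> F \<and> sigma k w \<in> F")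
  case False
  then have "G1 = G2"
    using facets_over_endpoint[OF F G(1)] facets_over_endpoint[OF F G(2)] by metis
  then show ?thesis ..
next
  case True
  have ex: "\<exists>f j. facet_path k n u w F (len n w - len n u) f j \<and> G = insert (sigma k (f j)) F \<and>
      0 < j \<and> j < len n w - len n u" if "G \<in> facets_over k n u w F" for G
  proof -
    have G': "k_chain k n u G w" "F \<subseteq> G" using that by (simp_all add: facets_over_def)
    obtain f j where f: "facet_path k n u w F (len n w - len n u) f j" "G = insert (sigma k (f j)) F"
      using facet_path_exists[OF G' F] .
    have "j \<le> len n w - len n u" using f(1) by (simp add: facet_path_def)
    then have "0 < j" "j < len n w - len n u"
      using facet_path_endpoint[OF f(1)] True by simp_all
    with f show ?thesis by (intro exI conjI)
  qed
  obtain f1 j1 where 1: "facet_path k n u w F (len n w - len n u) f1 j1"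
    "G1 = insert (sigma k (f1 j1)) F" "0 < j1" "j1 < len n w - len n u" using ex[OF G(1)] by metis
  obtain f2 j2 where 2: "facet_path k n u w F (len n w - len n u) f2 j2"
    "G2 = insert (sigma k (f2 j2)) F" "0 < j2" "j2 < len n w - len n u" using ex[OF G(2)] by metis
  obtain f3 j3 where 3: "facet_path k n u w F (len n w - len n u) f3 j3"
    "G3 = insert (sigma k (f3 j3)) F" "0 < j3" "j3 < len n w - len n u" using ex[OF G(3)] by metis
  note T = three_facets_not_distinct
  consider "j1 \<le> j2" "j2 \<le> j3" | "j1 \<le> j3" "j3 \<le> j2" | "j2 \<le> j1" "j1 \<le> j3"
    | "j2 \<le> j3" "j3 \<le> j1" | "j3 \<le> j1" "j1 \<le> j2" | "j3 \<le> j2" "j2 \<le> j1" by linarith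
  then have "sigma k (f1 j1) = sigma k (f2 j2) \<or> sigma k (f1 j1) = sigma k (f3 j3) \<or>
    sigma k (f2 j2) = sigma k (f3 j3)"
  proof cases
    case order: 1
    show ?thesis using T[OF 1(1) 2(1) 3(1) order 1(3) 3(4)] .
  next
    case order: 2
    show ?thesis using T[OF 1(1) 3(1) 2(1) order 1(3) 2(4)] by auto
  next
    case order: 3
    show ?thesis using T[OF 2(1) 1(1) 3(1) order 2(3) 3(4)] by auto
  next
    case order: 4
    show ?thesis using T[OF 2(1) 3(1) 1(1) order 2(3) 1(4)] by auto
  next
    case order: 5
    show ?thesis using T[OF 3(1) 1(1) 2(1) order 3(3) 2(4)] by auto
  next
    case order: 6
    show ?thesis using T[OF 3(1) 2(1) 1(1) order 3(3) 1(4)] by auto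
  qed
  then show ?thesis unfolding 1(2) 2(2) 3(2) by (elim disjE) simp_all
qed

lemma card_one_or_two:
  assumes "x \<in> S" "\<And>a b c. a \<in> S \<Longrightarrow> b \<in> S \<Longrightarrow> c \<in> S \<Longrightarrow> a = b \<or> a = c \<or> b = c"
  shows "card S = 1 \<or> card S = 2"
proof (cases "S = {x}")
  case False
  then obtain y where y: "y \<in> S" "y \<noteq> x" using assms(1) by blast
  then have "S = {x, y}" using assms by blast
  then show ?thesis using y by simp
qed simp

section \<open>Ridges that collapse at the upper end\<close>

text \<open>
  Here \<open>F\<close> is itself the image of a \<open>k\<close>-Bruhat chain from \<open>u\<close>. This chain plays the part of a third
  top face whose gap comes after all others, and excludes a second top face by the same arguments.
\<close>

lemma facets_over_collapsed_end:
  assumes x: "k_chain k n u F x" "block_cover k n x w"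
    and G: "G1 \<in> facets_over k n u w F" "G2 \<in> facets_over k n u w F"
  shows "G1 = G2"
proof -
  have lw: "len n w = Suc (len n x)" and sw: "sigma k x = sigma k w"
    using x(2) unfolding block_cover_def bruhat_cover_iff by simp_all
  obtain h m where h: "h 0 = u" "h m = x" "k_path k n h m" "F = (\<lambda>i. sigma k (h i)) ` {..m}"
    "len n x = len n u + m" using k_chain_path[OF x(1)] by blast
  define r where "r = len n w - len n u"
  have r: "r = Suc m" using lw h(5) by (simp add: r_def)
  have F: "card F = r" using k_path_card[OF h(3)] h(4) r by simp
  have ends: "sigma k u \<in> F" "sigma k w \<in> F" using chain_image_ends[OF x(1)] sw by auto
  have hs: "sigma k (h i) = sigma k (f (skip j i))" if f: "facet_path k n u w F r f j" and "i < r" for f i j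
  proof (rule strict_enumeration_unique[where wt = Sum and m = r and i = i
      and s = "\<lambda>i. sigma k (h i)" and t = "\<lambda>i. sigma k (f (skip j i))"])
    show "(\<lambda>i. sigma k (h i)) ` {..<r} = (\<lambda>i. sigma k (f (skip j i))) ` {..<r}"
      using facet_path_skip(1)[OF f] h(4) by (simp add: r lessThan_Suc_atMost)
  qed (use that facet_path_skip(2)[OF f] k_path_sum_less[OF h(3)] r in auto)
  have low: "h i = f i" if f: "facet_path k n u w F r f j" and "i < j" for f i j
  proof (rule k_path_agree_low[OF h(3), where m = "j - 1" and r' = r])
    have "j \<le> r" using f by (simp add: facet_path_def)
    show "sigma k (h l) = sigma k (f l)" if l: "l \<le> j - 1" for l
    proof -
      have "l < j" "l < r" using l \<open>i < j\<close> \<open>j \<le> r\<close> by linarith+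
      then show ?thesis using hs[OF f, of l] by (simp add: skip_def)
    qed
  qed (use f h(1) r \<open>i < j\<close> in \<open>auto simp: facet_path_def\<close>)
  have main: "sigma k (f j) = sigma k (g j')"
    if f: "facet_path k n u w F r f j" and g: "facet_path k n u w F r g j'" and le: "j \<le> j'"
    for f g j j'
  proof -
    have j: "0 < j" "j' < r"
      using facet_path_endpoint[OF f] facet_path_endpoint[OF g] ends g by (auto simp: facet_path_def)
    have "k_bruhat_cover k n (h (j' - 1)) (h (Suc (j' - 1)))"
      using h(3)[unfolded k_path_def, rule_format, of "j' - 1"] j le r by simp
    then have c: "k_bruhat_cover k n (g (j' - 1)) (h j')" "sigma k (h j') = sigma k (g (Suc j'))"
      using low[OF g, of "j' - 1"] hs[OF g, of j'] j le by (simp_all add: skip_def)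
    show ?thesis
    proof (cases "j = j'")
      case False
      with le have "j < j'" by simp
      from later_gap_not_single[OF f g this j(2) c] show ?thesis ..
    next
      case True
      obtain a where "sigma k (g (j' - 1)) - sigma k (g (Suc j')) = {a}"
        using k_cover_single[OF c(1)] c(2) by auto
      from middle_unique[OF _ _ _ _ this, of n "f j'" "g j'"]
      show ?thesis
        using facet_path_cover[OF f, of "j' - 1"] facet_path_cover[OF f, of j']
          facet_path_cover[OF g, of "j' - 1"] facet_path_cover[OF g, of j']
          facet_paths_low[OF f g, of "j' - 1"] facet_paths_high[OF f g, of "Suc j'"] j True by simp
    qed
  qed
  have G': "k_chain k n u G1 w" "F \<subseteq> G1" "k_chain k n u G2 w" "F \<subseteq> G2"
    using G by (simp_all add: facets_over_def)
  obtain f j where f: "facet_path k n u w F r f j" "G1 = insert (sigma k (f j)) F"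
    using facet_path_exists[OF G'(1,2) F[unfolded r_def]] unfolding r_def .
  obtain g j' where g: "facet_path k n u w F r g j'" "G2 = insert (sigma k (g j')) F"
    using facet_path_exists[OF G'(3,4) F[unfolded r_def]] unfolding r_def .
  have "sigma k (f j) = sigma k (g j')"
    using main[OF f(1) g(1)] main[OF g(1) f(1)] by (cases j j' rule: le_cases) simp_all
  then show ?thesis using f(2) g(2) by simp
qed

section \<open>Faces, ridges and exterior ridges in terms of k-Bruhat chains\<close>

lemma k_chain_bruhat_le: "k_chain k n u F w \<Longrightarrow> u \<in> Sym n \<Longrightarrow> bruhat_le n u w"
  by (induction rule: chain_image.induct)
    (auto simp: bruhat_le_iff_covers k_bruhat_cover_def intro: rtranclp.rtrancl_into_rtrancl)

lemma k_bruhat_le_iff_chain: "k_bruhat_le k n u w \<longleftrightarrow> u \<in> Sym n \<and> (\<exists>F. k_chain k n u F w)"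
  using chain_image_rtranclp[of k "k_bruhat_cover k n" u _ w]
    rtranclp_chain_image[of "k_bruhat_cover k n" u w k]
  unfolding k_bruhat_le_def by blast

lemma k_chain_order_complex:
  assumes "k_chain k n u F w" "u \<in> Sym n"
  shows "\<exists>C \<in> order_complex n u w. sigma k ` C = F"
  using assms(1)
proof (induction rule: chain_image.induct)
  case start
  have "{u} \<in> order_complex n u u"
    using bruhat_le_refl[OF assms(2)] by (simp add: order_complex_def bruhat_interval_def chain_def)
  then show ?case by (intro bexI[of _ "{u}"]) simp_all
next
  case (step F v w)
  then obtain C where C: "C \<in> order_complex n u v" "sigma k ` C = F" by blast
  have v: "v \<in> Sym n" and vw: "bruhat_le n v w"
    using k_chain_Sym[OF step.hyps(1) assms(2)] step.hyps(2)
    by (auto simp: bruhat_le_iff_covers k_bruhat_cover_def)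
  have uw: "bruhat_le n u w"
    using k_chain_bruhat_le[OF step.hyps(1) assms(2)] vw by (rule bruhat_le_trans)
  have w: "bruhat_le n w w" using bruhat_le_Sym[OF vw] by (simp add: bruhat_le_refl)
  have Cw: "bruhat_le n c w" if "c \<in> C" for c
    using C(1) that vw by (auto simp: order_complex_def bruhat_interval_def intro: bruhat_le_trans)
  have "insert w C \<in> order_complex n u w"
    using C(1) Cw uw w by (auto simp: order_complex_def bruhat_interval_def chain_def)
  then show ?case using C(2) by (intro bexI[of _ "insert w C"]) simp_all
qed

lemma finite_Sym: "finite (Sym n)"
  by (simp add: Sym_def finite_permutations)

lemma bruhat_le_chain_image:
  "bruhat_le n x y \<Longrightarrow> \<exists>F. chain_image k (bruhat_cover n) x F y"
  unfolding bruhat_le_iff_covers using rtranclp_chain_image by blast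

text \<open>
  By induction on the chain \<open>C\<close>, removing its longest element \<open>x\<close>: the rest lies in \<open>[u,x]\<close>.
\<close>

lemma order_complex_chain_image:
  assumes "C \<in> order_complex n u w" "bruhat_le n u w"
  shows "\<exists>F. sigma k ` C \<subseteq> F \<and> chain_image k (bruhat_cover n) u F w"
proof -
  have "finite C"
    using assms(1) finite_Sym[of n]
    by (auto simp: order_complex_def bruhat_interval_def dest: bruhat_le_Sym
      intro: finite_subset[of C "Sym n"])
  then have "\<forall>w. C \<in> order_complex n u w \<longrightarrow> bruhat_le n u w \<longrightarrow>
      (\<exists>F. sigma k ` C \<subseteq> F \<and> chain_image k (bruhat_cover n) u F w)"
  proof (induction C rule: finite_ranking_induct[where f = "len n"])
    case empty
    then show ?case using bruhat_le_chain_image by simp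
  next
    case (insert x C)
    show ?case
    proof (intro allI impI)
      fix w assume C: "insert x C \<in> order_complex n u w" and "bruhat_le n u w"
      have x: "bruhat_le n u x" "bruhat_le n x w"
        using C by (auto simp: order_complex_def bruhat_interval_def)
      have "bruhat_le n c x" if "c \<in> C" for c
      proof -
        have "bruhat_le n c x \<or> bruhat_le n x c"
          using C that by (auto simp: order_complex_def chain_def)
        then show ?thesis
          using insert.hyps(2)[OF that] bruhat_less_len[of n x c] unfolding bruhat_less_def by force
      qed
      then have "C \<in> order_complex n u x"
        using C by (auto simp: order_complex_def bruhat_interval_def chain_def)
      then obtain F where F: "sigma k ` C \<subseteq> F" "chain_image k (bruhat_cover n) u F x"
        using insert.IH x(1) by blast
      obtain F' where F': "chain_image k (bruhat_cover n) x F' w"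
        using bruhat_le_chain_image[OF x(2)] by blast
      have "sigma k ` insert x C \<subseteq> F \<union> F'" using F(1) chain_image_ends[OF F'] by auto
      then show "\<exists>F. sigma k ` insert x C \<subseteq> F \<and> chain_image k (bruhat_cover n) u F w"
        using chain_image_append[OF F' F(2)] by blast
    qed
  qed
  then show ?thesis using assms by blast
qed

text \<open>
  The complex is pure: a face extends to the image of a Bruhat chain from \<open>u\<close> to \<open>w\<close>, and this one
  lies in the image of a \<open>k\<close>-Bruhat chain.
\<close>

lemma sigma_complex_iff:
  assumes u: "u \<in> Sym n" and H: "k_chain k n u H w"
  shows "F \<in> sigma_complex k n u w \<longleftrightarrow> (\<exists>G. k_chain k n u G w \<and> F \<subseteq> G)"
proof
  assume "F \<in> sigma_complex k n u w"
  then obtain C where C: "C \<in> order_complex n u w" "F = sigma k ` C"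
    by (auto simp: sigma_complex_def)
  obtain F' where F': "F \<subseteq> F'" "chain_image k (bruhat_cover n) u F' w"
    using order_complex_chain_image[OF C(1) k_chain_bruhat_le[OF H u]] C(2) by blast
  obtain G where "F' \<subseteq> G" "k_chain k n u G w"
    using bruhat_chain_in_k_chain[OF u H F'(2)] by blast
  then show "\<exists>G. k_chain k n u G w \<and> F \<subseteq> G" using F'(1) by (intro exI[of _ G]) simp
next
  assume "\<exists>G. k_chain k n u G w \<and> F \<subseteq> G"
  then obtain G where G: "k_chain k n u G w" "F \<subseteq> G" by blast
  obtain C where C: "C \<in> order_complex n u w" "sigma k ` C = G"
    using k_chain_order_complex[OF G(1) u] by blast
  \<comment> \<open>A subset of a face is the image of the corresponding subchain.\<close>
  have "{c \<in> C. sigma k c \<in> F} \<in> order_complex n u w"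
    using C(1) by (auto simp: order_complex_def chain_def)
  moreover have "F = sigma k ` {c \<in> C. sigma k c \<in> F}" using C(2) G(2) by auto
  ultimately show "F \<in> sigma_complex k n u w"
    unfolding sigma_complex_def by (rule rev_image_eqI)
qed

lemma top_faces_over:
  assumes u: "u \<in> Sym n" and H: "k_chain k n u H w"
  shows "{G \<in> top_faces k n u w. F \<subseteq> G} = facets_over k n u w F"
proof -
  have l: "len n u \<le> len n w" by (rule k_chain_len[OF H])
  have "G \<in> top_faces k n u w \<longleftrightarrow> k_chain k n u G w" for G
  proof
    assume "G \<in> top_faces k n u w"
    then have "G \<in> sigma_complex k n u w" and c: "card G = Suc (len n w - len n u)"
      using l by (auto simp: top_faces_def face_dim_def)
    then obtain G' where G': "k_chain k n u G' w" "G \<subseteq> G'"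
      using sigma_complex_iff[OF u H] by blast
    then have "G = G'" using c k_chain_card[OF G'(1)] by (simp add: card_subset_eq)
    then show "k_chain k n u G w" using G' by simp
  next
    assume G: "k_chain k n u G w"
    then have "G \<in> sigma_complex k n u w" using sigma_complex_iff[OF u H] by blast
    then show "G \<in> top_faces k n u w"
      using k_chain_card[OF G] l by (simp add: top_faces_def face_dim_def)
  qed
  then show ?thesis by (auto simp: facets_over_def)
qed

lemma ridges_iff:
  assumes u: "u \<in> Sym n" and H: "k_chain k n u H w"
  shows "F \<in> ridges k n u w \<longleftrightarrow> card F = len n w - len n u \<and> facets_over k n u w F \<noteq> {}"
  using k_chain_len[OF H] sigma_complex_iff[OF u H, of F]
  by (auto simp: ridges_def face_dim_def facets_over_def)

lemma exterior_ridge_iff: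
  assumes u: "u \<in> Sym n" and H: "k_chain k n u H w"
  shows "exterior_ridge k n u w F \<longleftrightarrow>
    card F = len n w - len n u \<and> card (facets_over k n u w F) = 1"
  unfolding exterior_ridge_def ridges_iff[OF u H] top_faces_over[OF u H] by auto

lemma exterior_ridgeI:
  assumes u: "u \<in> Sym n" and "card F = len n w - len n u" "G \<in> facets_over k n u w F"
    and "\<And>G'. G' \<in> facets_over k n u w F \<Longrightarrow> G' = G"
  shows "exterior_ridge k n u w F"
proof -
  have G: "k_chain k n u G w" using assms(3) by (simp add: facets_over_def)
  have "facets_over k n u w F = {G}" using assms(3,4) by blast
  then show ?thesis unfolding exterior_ridge_iff[OF u G] using assms(2) by simp
qed

text \<open>
  Ridges and top faces depend on \<open>u\<close> and \<open>w\<close> only through the images of the \<open>k\<close>-Bruhat chains and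
  the length difference, and both are invariants of the class of the interval.
\<close>

lemma exterior_ridge_cong:
  assumes "u \<in> Sym n" "u' \<in> Sym n" "k_chain k n u H w"
    and eq: "\<And>G. k_chain k n u G w \<longleftrightarrow> k_chain k n u' G w'"
    and "len n w + len n u' = len n w' + len n u"
  shows "exterior_ridge k n u w F \<longleftrightarrow> exterior_ridge k n u' w' F"
proof -
  have H': "k_chain k n u' H w'" using assms(3) eq by blast
  have "facets_over k n u w F = facets_over k n u' w' F" by (simp add: facets_over_def eq)
  moreover have "len n w - len n u = len n w' - len n u'"
    using assms(5) k_chain_len[OF assms(3)] k_chain_len[OF H'] by linarith
  ultimately show ?thesis
    unfolding exterior_ridge_iff[OF assms(1,3)] exterior_ridge_iff[OF assms(2) H'] by simp
qed

section \<open>Faces that avoid an end of the interval\<close>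

text \<open>
  The reduction leaves a chain that misses \<open>wz\<close> by one block cover. Its image is a ridge that
  collapses at the upper end.
\<close>

lemma block_gap_exterior:
  assumes u: "u \<in> Sym n" and H: "k_chain k n u H w" and F: "k_chain k n u F x"
    and "(block_step k n)\<^sup>*\<^sup>* x w" "x \<noteq> w"
  shows "\<exists>R. exterior_ridge k n u w R \<and> F \<subseteq> R"
proof -
  from block_gap_reduction[OF assms]
  obtain z y R i where z: "z \<in> parabolic k n" and P: "F \<subseteq> R" "same_block k n i (Suc i)"
    "k_chain k n (u \<circ> z) R y" "y i < y (Suc i)" "w \<circ> z = y \<circ> transpose i (Suc i)"
    "k_chain k n (u \<circ> z) H (w \<circ> z)"
    "len n (w \<circ> z) + len n u = len n (u \<circ> z) + len n w"
    by blast
  have uz: "u \<circ> z \<in> Sym n" by (rule Sym_comp[OF u parabolic_Sym[OF z]])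
  have y: "y \<in> Sym n" by (rule k_chain_Sym[OF P(3) uz])
  have l: "len n (w \<circ> z) = Suc (len n y)" unfolding P(5) by (rule len_simple_up[OF y P(2,4)])
  have b: "block_cover k n y (w \<circ> z)"
    using block_coverI[OF y P(2,4)] l unfolding P(5) by simp
  obtain G where G: "R \<subseteq> G" "k_chain k n (u \<circ> z) G (w \<circ> z)"
    using k_then_blocks_in_k_chain[OF uz P(6,3) block_covers_steps] b by blast
  have "card R = len n (w \<circ> z) - len n (u \<circ> z)"
    using k_chain_card[OF P(3)] l k_chain_len[OF P(3)] by simp
  then have "exterior_ridge k n (u \<circ> z) (w \<circ> z) R"
    using G facets_over_collapsed_end[OF P(3) b]
    by (intro exterior_ridgeI[OF uz, of R "w \<circ> z" G]) (auto simp: facets_over_def)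
  then have "exterior_ridge k n u w R"
    using exterior_ridge_cong[OF u uz H, of "w \<circ> z"] k_chain_twist_iff[OF z P(7)] P(7) by simp
  then show ?thesis using P(1) by blast
qed

lemma k_chain_sum_le: "k_chain k n u F w \<Longrightarrow> S \<in> F \<Longrightarrow> \<Sum>S \<le> \<Sum>(sigma k w)"
proof (induction rule: chain_image.induct)
  case (step F v w)
  then show ?case using k_cover_sum_less[OF step.hyps(2)] by fastforce
qed simp

text \<open>
  Prolonging the chain up to the last element before \<open>w\<close> gives a ridge that omits only the image
  of \<open>w\<close>, so only one top face contains it.
\<close>

lemma k_truncation_exterior:
  assumes u: "u \<in> Sym n" and F: "k_chain k n u F y" and H: "k_chain k n y H w" and "y \<noteq> w"
  shows "\<exists>R. exterior_ridge k n u w R \<and> F \<subseteq> R"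
proof -
  from H \<open>y \<noteq> w\<close> obtain F' v where v: "k_chain k n y F' v" "k_bruhat_cover k n v w"
    by (auto elim: chain_image.cases)
  let ?R = "F \<union> F'"
  have R: "k_chain k n u ?R v" by (rule chain_image_append[OF v(1) F])
  have "sigma k w \<notin> ?R" using k_chain_sum_le[OF R] k_cover_sum_less[OF v(2)] by fastforce
  moreover have c: "card ?R = len n w - len n u"
    using k_chain_card[OF R] k_chain_len[OF R] k_cover_len[OF v(2)] by simp
  moreover have "k_chain k n u (insert (sigma k w) ?R) w" by (rule k_chain_step[OF R v(2)])
  ultimately have "exterior_ridge k n u w ?R"
    using facets_over_endpoint(2)[OF c]
    by (intro exterior_ridgeI[OF u, of _ _ "insert (sigma k w) ?R"]) (auto simp: facets_over_def)
  then show ?thesis by blast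
qed

lemma block_covers_len: "(block_cover k n)\<^sup>*\<^sup>* x y \<Longrightarrow> len n x \<le> len n y"
  using block_steps_len[OF block_covers_steps] by fastforce

text \<open>
  Block covers are moved upwards, first between \<open>u\<close> and \<open>y\<close> and then between the resulting \<open>x\<close> and
  \<open>w\<close>. If block covers remain at the top, the face lies in a ridge that collapses there. If none
  remains, the chain through the face stops at \<open>x\<close>, strictly below \<open>w\<close>, and can be prolonged.
\<close>

lemma lower_chain_exterior:
  assumes u: "u \<in> Sym n" and H: "k_chain k n u H w"
    and F: "chain_image k (bruhat_cover n) u F y" and yw: "bruhat_less n y w"
  shows "\<exists>R. exterior_ridge k n u w R \<and> F \<subseteq> R"
proof -
  obtain x F1 where x: "F \<subseteq> F1" "k_chain k n u F1 x" "(block_cover k n)\<^sup>*\<^sup>* x y"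
    using bruhat_chain_k_then_block[OF F] by blast
  have "(bruhat_cover n)\<^sup>*\<^sup>* x y"
    using x(3) by (rule rtranclp_mono[THEN predicate2D, rotated]) (auto simp: block_cover_def)
  moreover have "(bruhat_cover n)\<^sup>*\<^sup>* y w"
    using yw by (simp add: bruhat_less_def bruhat_le_iff_covers)
  ultimately have "(bruhat_cover n)\<^sup>*\<^sup>* x w" by (rule rtranclp_trans)
  then obtain F' where "chain_image k (bruhat_cover n) x F' w"
    using rtranclp_chain_image by blast
  then obtain v F2 where v: "k_chain k n x F2 v" "(block_cover k n)\<^sup>*\<^sup>* v w"
    using bruhat_chain_k_then_block by blast
  show ?thesis
  proof (cases "v = w")
    case True
    have "x \<noteq> w" using block_covers_len[OF x(3)] bruhat_less_len[OF yw] by auto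
    from k_truncation_exterior[OF u x(2) v(1)[unfolded True] this] x(1) show ?thesis by blast
  next
    case False
    from block_gap_exterior[OF u H chain_image_append[OF v(1) x(2)] block_covers_steps[OF v(2)] False]
    show ?thesis using x(1) by blast
  qed
qed

section \<open>Reversal of values\<close>

text \<open>
  Composition with the longest element on the left reverses the Bruhat and the \<open>k\<close>-Bruhat order and
  acts on images elementwise. It transfers the result about the upper end of an interval to the
  lower end.
\<close>

definition flip :: "nat \<Rightarrow> nat \<Rightarrow> nat" where
  "flip n i = (if i \<in> {1..n} then Suc n - i else i)"

lemma flip_flip [simp]: "flip n (flip n i) = i"
  by (auto simp: flip_def)

lemma flip_comp_flip [simp]: "flip n \<circ> (flip n \<circ> v) = v"
  by (simp add: fun_eq_iff)

lemma flip_Sym: "flip n \<in> Sym n"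
  unfolding Sym_def
  by (auto intro!: bij_imp_permutes bij_betwI[where g = "flip n"] simp: flip_def)

lemma flip_comp_Sym: "v \<in> Sym n \<Longrightarrow> flip n \<circ> v \<in> Sym n"
  by (rule Sym_comp[OF flip_Sym])

lemma sigma_flip: "sigma k (flip n \<circ> v) = flip n ` sigma k v"
  unfolding sigma_def by (rule image_comp[symmetric])

lemma len_flip:
  assumes "v \<in> Sym n"
  shows "len n v + len n (flip n \<circ> v) = card {(i, j). 1 \<le> i \<and> i < j \<and> j \<le> n}"
proof -
  let ?P = "{(i, j). 1 \<le> i \<and> i < j \<and> j \<le> n}"
  have v: "v i \<in> {1..n}" if "1 \<le> i" "i \<le> n" for i
    using permutes_in_image[of v "{1..n}" i] assms that by (simp add: Sym_def)
  have "flip n (v j) < flip n (v i) \<longleftrightarrow> v i < v j" if "1 \<le> i" "i < j" "j \<le> n" for i j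
    using v[of i] v[of j] that by (auto simp: flip_def)
  moreover have "v i < v j \<longleftrightarrow> \<not> v j < v i" if "i < j" for i j
    using Sym_inj[OF assms] that by (metis inj_eq less_irrefl nat_neq_iff less_asym)
  ultimately have "inv_pairs n (flip n \<circ> v) = ?P - inv_pairs n v"
    by (auto simp: inv_pairs_def)
  moreover have "finite ?P" by (rule finite_subset[of _ "{1..n} \<times> {1..n}"]) auto
  moreover have "inv_pairs n v \<subseteq> ?P" by (auto simp: inv_pairs_def)
  ultimately show ?thesis
    unfolding len_eq_card_inv_pairs by (simp add: card_Diff_subset card_mono)
qed

lemma bruhat_cover_flip:
  assumes "bruhat_cover n x y"
  shows "bruhat_cover n (flip n \<circ> y) (flip n \<circ> x)"
proof -
  obtain a b where ab: "x \<in> Sym n" "1 \<le> a" "a < b" "b \<le> n" "y = x \<circ> transpose a b"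
    "len n y = Suc (len n x)" using assms unfolding bruhat_cover_iff by blast
  have y: "y \<in> Sym n" unfolding ab(5) using ab by (intro Sym_transpose) auto
  have "len n (flip n \<circ> x) = Suc (len n (flip n \<circ> y))"
    using len_flip[OF ab(1)] len_flip[OF y] ab(6) by linarith
  moreover have "flip n \<circ> x = flip n \<circ> y \<circ> transpose a b"
    unfolding ab(5) by (simp add: comp_assoc)
  ultimately show ?thesis
    unfolding bruhat_cover_iff using flip_comp_Sym[OF y] ab(2-4) by blast
qed

lemma k_bruhat_cover_flip:
  assumes "k_bruhat_cover k n x y"
  shows "k_bruhat_cover k n (flip n \<circ> y) (flip n \<circ> x)"
proof -
  have "inj (flip n)" by (rule Sym_inj[OF flip_Sym])
  then show ?thesis
    using assms bruhat_cover_flip[of n x y]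
    by (auto simp: k_bruhat_cover_def sigma_flip inj_image_eq_iff)
qed

definition flip_sets :: "nat \<Rightarrow> nat set set \<Rightarrow> nat set set" where
  "flip_sets n F = (`) (flip n) ` F"

lemma flip_sets_flip_sets [simp]: "flip_sets n (flip_sets n F) = F"
proof -
  have "flip n ` flip n ` S = S" for S by (simp add: image_image)
  then show ?thesis by (simp add: flip_sets_def image_image)
qed

lemma flip_sets_subset_iff: "flip_sets n F \<subseteq> G \<longleftrightarrow> F \<subseteq> flip_sets n G"
  by (metis flip_sets_def flip_sets_flip_sets image_mono)

lemma chain_image_flip:
  assumes "chain_image k R u F w" and R: "\<And>x y. R x y \<Longrightarrow> R (flip n \<circ> y) (flip n \<circ> x)"
  shows "chain_image k R (flip n \<circ> w) (flip_sets n F) (flip n \<circ> u)"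
  using assms(1)
proof (induction rule: chain_image.induct)
  case start
  have "flip_sets n {sigma k u} = {sigma k (flip n \<circ> u)}" by (simp add: flip_sets_def sigma_flip)
  then show ?case using chain_image.start[of k R "flip n \<circ> u"] by (simp only:)
next
  case (step F v w)
  let ?one = "insert (sigma k (flip n \<circ> v)) {sigma k (flip n \<circ> w)}"
  have "chain_image k R (flip n \<circ> w) ?one (flip n \<circ> v)"
    using chain_image.step[of k R "flip n \<circ> w" _ "flip n \<circ> w" "flip n \<circ> v"]
      chain_image.start[of k R "flip n \<circ> w"] R[OF step.hyps(2)] by blast
  from chain_image_append[OF step.IH this]
  have "chain_image k R (flip n \<circ> w) (?one \<union> flip_sets n F) (flip n \<circ> u)" .
  moreover have "?one \<union> flip_sets n F = flip_sets n (insert (sigma k w) F)"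
    using chain_image_ends[OF step.hyps(1)] by (auto simp: flip_sets_def sigma_flip)
  ultimately show ?case by (simp only:)
qed

lemma k_chain_flip_iff:
  "k_chain k n (flip n \<circ> w) (flip_sets n F) (flip n \<circ> u) \<longleftrightarrow> k_chain k n u F w"
  using chain_image_flip[of k "k_bruhat_cover k n" "flip n \<circ> w" "flip_sets n F" "flip n \<circ> u" n]
    chain_image_flip[of k "k_bruhat_cover k n" u F w n] k_bruhat_cover_flip[of k n]
  by auto

lemma exterior_ridge_flip:
  assumes u: "u \<in> Sym n" and H: "k_chain k n u H w"
    and R: "exterior_ridge k n (flip n \<circ> w) (flip n \<circ> u) R"
  shows "exterior_ridge k n u w (flip_sets n R)"
proof -
  have w: "w \<in> Sym n" by (rule k_chain_Sym[OF H u])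
  have H': "k_chain k n (flip n \<circ> w) (flip_sets n H) (flip n \<circ> u)"
    using H by (simp only: k_chain_flip_iff)
  have l: "len n (flip n \<circ> u) - len n (flip n \<circ> w) = len n w - len n u"
    using len_flip[OF u] len_flip[OF w] by linarith
  have inj: "inj (flip_sets n)" by (metis injI flip_sets_flip_sets)
  have ij: "inj ((`) (flip n))" using Sym_inj[OF flip_Sym] by (simp add: inj_image_eq_iff inj_def)
  have "facets_over k n u w (flip_sets n R) = flip_sets n ` facets_over k n (flip n \<circ> w) (flip n \<circ> u) R"
  proof (intro equalityI subsetI)
    fix G assume G: "G \<in> facets_over k n u w (flip_sets n R)"
    then have "flip_sets n G \<in> facets_over k n (flip n \<circ> w) (flip n \<circ> u) R"
      by (simp add: facets_over_def k_chain_flip_iff flip_sets_subset_iff)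
    then show "G \<in> flip_sets n ` facets_over k n (flip n \<circ> w) (flip n \<circ> u) R"
      by (rule rev_image_eqI) simp
  next
    fix G assume "G \<in> flip_sets n ` facets_over k n (flip n \<circ> w) (flip n \<circ> u) R"
    then obtain G' where G': "G = flip_sets n G'" "R \<subseteq> G'"
      "k_chain k n (flip n \<circ> w) G' (flip n \<circ> u)" by (auto simp: facets_over_def)
    then have "k_chain k n (flip n \<circ> w) (flip_sets n G) (flip n \<circ> u)" by simp
    then show "G \<in> facets_over k n u w (flip_sets n R)"
      unfolding k_chain_flip_iff using G' by (simp add: facets_over_def flip_sets_subset_iff)
  qed
  then have "card (facets_over k n u w (flip_sets n R)) = 1"
    using R unfolding exterior_ridge_iff[OF flip_comp_Sym[OF w] H']
    by (simp add: card_image inj_on_subset[OF inj])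
  moreover have "card (flip_sets n R) = len n w - len n u"
    using R l unfolding exterior_ridge_iff[OF flip_comp_Sym[OF w] H']
    by (simp add: flip_sets_def card_image inj_on_subset[OF ij])
  ultimately show ?thesis unfolding exterior_ridge_iff[OF u H] by blast
qed

lemma upper_chain_exterior:
  assumes u: "u \<in> Sym n" and H: "k_chain k n u H w"
    and F: "chain_image k (bruhat_cover n) x F w" and ux: "bruhat_less n u x"
  shows "\<exists>R. exterior_ridge k n u w R \<and> F \<subseteq> R"
proof -
  let ?d = "(\<circ>) (flip n)"
  have w: "w \<in> Sym n" by (rule k_chain_Sym[OF H u])
  have x: "x \<in> Sym n" using ux bruhat_le_Sym by (auto simp: bruhat_less_def)
  have H': "k_chain k n (?d w) (flip_sets n H) (?d u)" using H by (simp only: k_chain_flip_iff)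
  have F': "chain_image k (bruhat_cover n) (?d w) (flip_sets n F) (?d x)"
    by (rule chain_image_flip[OF F]) (rule bruhat_cover_flip)
  have "(bruhat_cover n)\<^sup>*\<^sup>* u x" using ux by (simp add: bruhat_less_def bruhat_le_iff_covers)
  then have "(bruhat_cover n)\<^sup>*\<^sup>* (?d x) (?d u)"
  proof (induction rule: rtranclp_induct)
    case (step y z)
    show ?case by (rule converse_rtranclp_into_rtranclp[OF bruhat_cover_flip[OF step.hyps(2)] step.IH])
  qed simp
  moreover have "?d x \<noteq> ?d u" using ux by (metis bruhat_less_def flip_comp_flip)
  ultimately have "bruhat_less n (?d x) (?d u)"
    using flip_comp_Sym[OF x] by (simp add: bruhat_less_def bruhat_le_iff_covers)
  from lower_chain_exterior[OF flip_comp_Sym[OF w] H' F' this]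
  obtain R where R: "exterior_ridge k n (?d w) (?d u) R" "flip_sets n F \<subseteq> R" by blast
  have "F \<subseteq> flip_sets n R" using R(2) by (simp only: flip_sets_subset_iff)
  then show ?thesis using exterior_ridge_flip[OF u H R(1)] by blast
qed

section \<open>Classes of k-Bruhat intervals\<close>

lemma Q_gen_chains:
  assumes "Q_gen k n p q"
  shows "k_chain k n (fst p) G (snd p) \<longleftrightarrow> k_chain k n (fst q) G (snd q)"
    "len n (snd p) + len n (fst q) = len n (snd q) + len n (fst p)"
proof -
  obtain z where z: "z \<in> parabolic k n" "q = (fst p \<circ> z, snd p \<circ> z)"
    "len n (fst p \<circ> z) = len n (fst p) + len n z" "len n (snd p \<circ> z) = len n (snd p) + len n z"
    using assms unfolding Q_gen_def by blast
  show "k_chain k n (fst p) G (snd p) \<longleftrightarrow> k_chain k n (fst q) G (snd q)"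
    using k_chain_twist_iff[OF z(1), of "snd p" "fst p" G] z(2-4) by simp
  show "len n (snd p) + len n (fst q) = len n (snd q) + len n (fst p)"
    using z(2-4) by simp
qed

lemma Q_rel_chains:
  assumes "equivclp (Q_gen k n) p q"
  shows "(\<forall>G. k_chain k n (fst p) G (snd p) \<longleftrightarrow> k_chain k n (fst q) G (snd q)) \<and>
    len n (snd p) + len n (fst q) = len n (snd q) + len n (fst p)"
  using assms
proof (induction rule: equivclp_induct)
  case (step q q')
  from step.hyps(2) show ?case
  proof
    assume "Q_gen k n q q'"
    from Q_gen_chains[OF this] step.IH show ?thesis by auto
  next
    assume "Q_gen k n q' q"
    from Q_gen_chains[OF this] step.IH show ?thesis by auto
  qed
qed simp

lemma mem_Q_class_iff:
  "q \<in> Q_class k n u w \<longleftrightarrow>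
     (u, w) \<in> k_intervals k n \<and> q \<in> k_intervals k n \<and> equivclp (Q_gen k n) (u, w) q"
  by (auto simp: Q_class_def Q_rel_def)

lemma Q_class_eqI:
  assumes "q \<in> Q_class k n u w" "q \<in> Q_class k n u' w'"
  shows "Q_class k n u w = Q_class k n u' w'"
proof -
  have "equivclp (Q_gen k n) (u, w) (u', w')"
    using assms by (meson mem_Q_class_iff equivclp_sym equivclp_trans)
  then show ?thesis
    using assms unfolding set_eq_iff mem_Q_class_iff by (meson equivclp_sym equivclp_trans)
qed

theorem lemma10p1:
  fixes k n :: nat and u w :: "nat \<Rightarrow> nat"
  assumes "k \<le> n" and "k_bruhat_le k n u w"
  shows "(\<forall>F \<in> ridges k n u w. exterior_ridge k n u w F \<or> interior_ridge k n u w F) \<and>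
    (\<forall>F u' w'. k_bruhat_le k n u' w' \<longrightarrow>
       Q_less k n (Q_class k n u w) (Q_class k n u' w') \<longrightarrow>
       F \<in> sigma_complex k n u' w' \<longrightarrow>
       (\<exists>G. exterior_ridge k n u w G \<and> F \<subseteq> G))"
proof (intro conjI ballI allI impI)
  obtain H where u: "u \<in> Sym n" and H: "k_chain k n u H w"
    using assms(2) unfolding k_bruhat_le_iff_chain by blast
  {
    fix F assume F: "F \<in> ridges k n u w"
    then have c: "card F = len n w - len n u" and "facets_over k n u w F \<noteq> {}"
      unfolding ridges_iff[OF u H] by auto
    then obtain G where "G \<in> facets_over k n u w F" by blast
    then have "card (facets_over k n u w F) = 1 \<or> card (facets_over k n u w F) = 2"
      by (rule card_one_or_two) (rule facets_over_not_three[OF c])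
    then show "exterior_ridge k n u w F \<or> interior_ridge k n u w F"
      using F by (simp add: exterior_ridge_def interior_ridge_def top_faces_over[OF u H])
  }
  fix F u' w'
  assume k': "k_bruhat_le k n u' w'"
    and less: "Q_less k n (Q_class k n u w) (Q_class k n u' w')"
    and F: "F \<in> sigma_complex k n u' w'"
  obtain H' where u': "u' \<in> Sym n" and H': "k_chain k n u' H' w'"
    using k' unfolding k_bruhat_le_iff_chain by blast
  obtain G where G: "k_chain k n u' G w'" "F \<subseteq> G" using F sigma_complex_iff[OF u' H'] by blast
  obtain x y a b where xy: "(x, y) \<in> Q_class k n u' w'" and ab: "(a, b) \<in> Q_class k n u w"
    and sub: "bruhat_interval n x y \<subseteq> bruhat_interval n a b"
    and ne: "Q_class k n u w \<noteq> Q_class k n u' w'"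
    using less unfolding Q_less_def Q_le_def by blast
  have eq': "(x, y) \<in> k_intervals k n" "equivclp (Q_gen k n) (u', w') (x, y)"
    and eq: "(a, b) \<in> k_intervals k n" "equivclp (Q_gen k n) (u, w) (a, b)"
    using xy ab by (simp_all add: mem_Q_class_iff)
  have x: "x \<in> Sym n" and a: "a \<in> Sym n"
    using eq'(1) eq(1) by (auto simp: k_intervals_def k_bruhat_le_iff_chain)
  have xyG: "k_chain k n x G y" using Q_rel_chains[OF eq'(2)] G(1) by simp
  have abH: "k_chain k n a H b" using Q_rel_chains[OF eq(2)] H by simp
  have "bruhat_le n x y" by (rule k_chain_bruhat_le[OF xyG x])
  then have "x \<in> bruhat_interval n a b" "y \<in> bruhat_interval n a b"
    using sub bruhat_le_refl[of x n] bruhat_le_refl[of y n] bruhat_le_Sym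
    by (auto simp: bruhat_interval_def)
  then have ends: "bruhat_le n a x" "bruhat_le n y b" by (simp_all add: bruhat_interval_def)
  have "chain_image k (bruhat_cover n) x G y"
    using xyG
  proof (induction rule: chain_image.induct)
    case (step F v w)
    then show ?case using chain_image.step[of k "bruhat_cover n"] by (simp add: k_bruhat_cover_def)
  qed (rule chain_image.start)
  note chain = this
  \<comment> \<open>Classes that differ have no common representative, so one of the ends is proper.\<close>
  have "\<not> (a = x \<and> b = y)" using ne Q_class_eqI[OF ab] xy by auto
  then have "\<exists>R. exterior_ridge k n a b R \<and> G \<subseteq> R"
  proof (cases "b = y")
    case False
    then have "bruhat_less n y b" using ends(2) by (auto simp: bruhat_less_def)
    obtain F' where F': "chain_image k (bruhat_cover n) a F' x"
      using bruhat_le_chain_image[OF ends(1)] by blast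
    from lower_chain_exterior[OF a abH chain_image_append[OF chain F'] \<open>bruhat_less n y b\<close>]
    show ?thesis by blast
  next
    case True
    assume "\<not> (a = x \<and> b = y)"
    with True have "bruhat_less n a x" using ends(1) by (auto simp: bruhat_less_def)
    then show ?thesis using upper_chain_exterior[OF a abH] chain True by blast
  qed
  then obtain R where R: "exterior_ridge k n a b R" "G \<subseteq> R" by blast
  have "exterior_ridge k n u w R"
    using R(1) exterior_ridge_cong[OF u a H, of b R] Q_rel_chains[OF eq(2)] by simp
  then show "\<exists>G. exterior_ridge k n u w G \<and> F \<subseteq> G" using R(2) G(2) by blast
qed

end
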